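(* Let $n\ge 2$ and let $B(0,1)\subset\mathbf{R}^n$ be the open unit ball. There exist a function $u \in W^{1,1}_{\mathrm{loc}}(B(0,1))$ and an elliptic $A \in C(B(0,1); \mathbf{R}^{n \times n})$ such that $u$ is a weak solution of $-\operatorname{div}(A\nabla u)=0$ in $B(0,1)$, $u\in W^{1,p}_{\mathrm{loc}}(B(0,1))$ for every $p\in(1,\infty)$, but $Du\notin \mathrm{BMO}_{\mathrm{loc}}(B(0,1))$.
   Context: Functions are real-valued. For an open set $\Omega\subset\mathbf{R}^n$, a bounded measurable map $A:\Omega\to\mathbf{R}^{n\times n}$ is called elliptic if $A(x)$ is a symmetric matrix for every $x\in\Omega$ and there exist constants $\lambda,\Lambda>0$ such that $\lambda|\xi|^2\le (A(x)\xi)\cdot\xi\le\Lambda|\xi|^2$ for every $x\in\Omega$ and $\xi\in\mathbf{R}^n$. A function $u\in W^{1,1}_{\mathrm{loc}}(\Omega)$ is a weak solution of $-\operatorname{div}(A\nabla u)=0$ in $\Omega$ if $\int_\Omega (A\nabla u)\cdot\nabla\varphi=0$ for every $\varphi\in C^1_c(\Omega)$. $Du$ denotes the weak gradient of $u$. For an open ball $U$, an integrable (vector-valued) function $f$ on $U$ belongs to $\mathrm{BMO}(U)$ if $\sup_{B\subset U}\frac{1}{|B|}\int_B |f-f_B|<\infty$, the supremum being over all balls $B\subset U$, with $f_B=\frac1{|B|}\int_B f$; $f\in\mathrm{BMO}_{\mathrm{loc}}(\Omega)$ means $f\in\mathrm{BMO}(U)$ for every open ball $U$ whose closure is a compact subset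 of $\Omega$. *)

theory Defs
  imports "HOL-Analysis.Analysis"
begin

definition grad :: "('a::real_inner \<Rightarrow> real) \<Rightarrow> 'a \<Rightarrow> 'a" where
  "grad f x = (THE D. GDERIV f x :> D)"

lemma grad_eqI:
  assumes "GDERIV f x :> D"
  shows "grad f x = D"
  unfolding grad_def
proof (rule the_equality)
  fix E assume "GDERIV f x :> E"
  with assms have "(\<lambda>h. h \<bullet> E) = (\<lambda>h. h \<bullet> D)"
    unfolding gderiv_def by (blast intro: has_derivative_unique)
  then have "\<forall>h. h \<bullet> E = h \<bullet> D"
    by (simp add: fun_eq_iff)
  then show "E = D"
    by (simp only: vector_eq_ldot)
qed (rule assms)

text \<open>Functions on \<open>\<Omega>\<close> are represented by total functions. In every notion below
  except \<open>C1_c\<close>, the values outside \<open>\<Omega>\<close> are irrelevant; an element of \<open>C1_c \<Omega>\<close> is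
  the extension by zero of a compactly supported \<open>C\<^sup>1\<close> function on \<open>\<Omega>\<close>.\<close>

definition C1_c :: "'a::euclidean_space set \<Rightarrow> ('a \<Rightarrow> real) set" where
  "C1_c \<Omega> = {\<phi>. (\<forall>x. GDERIV \<phi> x :> grad \<phi> x) \<and> continuous_on UNIV (grad \<phi>)
      \<and> compact (closure {x. \<phi> x \<noteq> 0}) \<and> closure {x. \<phi> x \<noteq> 0} \<subseteq> \<Omega>}"

definition Lp_loc ::
  "real \<Rightarrow> 'a::euclidean_space set \<Rightarrow> ('a \<Rightarrow> 'b::euclidean_space) set" where
  "Lp_loc p \<Omega> = {f. f \<in> borel_measurable (lebesgue_on \<Omega>)
      \<and> (\<forall>K. compact K \<and> K \<subseteq> \<Omega> \<longrightarrow> set_integrable lebesgue K (\<lambda>x. norm (f x) powr p))}"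

text \<open>The weak gradient is unique only up to null sets, hence a relation. For open \<open>\<Omega>\<close>, the
  integrability conditions make both integrands integrable, so that no integral takes its default value.\<close>

definition has_weak_gradient ::
  "'a::euclidean_space set \<Rightarrow> ('a \<Rightarrow> real) \<Rightarrow> ('a \<Rightarrow> 'a) \<Rightarrow> bool" where
  "has_weak_gradient \<Omega> u Du \<longleftrightarrow> u \<in> Lp_loc 1 \<Omega> \<and> Du \<in> Lp_loc 1 \<Omega>
      \<and> (\<forall>\<phi>\<in>C1_c \<Omega>. (LINT x:\<Omega>|lebesgue. u x *\<^sub>R grad \<phi> x)
                   = - (LINT x:\<Omega>|lebesgue. \<phi> x *\<^sub>R Du x))"

definition W1p_loc :: "real \<Rightarrow> 'a::euclidean_space set \<Rightarrow> ('a \<Rightarrow> real) set" where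
  "W1p_loc p \<Omega> = {u. u \<in> Lp_loc p \<Omega> \<and> (\<exists>Du. has_weak_gradient \<Omega> u Du \<and> Du \<in> Lp_loc p \<Omega>)}"

definition elliptic :: "(real^'n) set \<Rightarrow> (real^'n \<Rightarrow> real^'n^'n) \<Rightarrow> bool" where
  "elliptic \<Omega> A \<longleftrightarrow> A \<in> borel_measurable (lebesgue_on \<Omega>) \<and> bounded (A ` \<Omega>)
      \<and> (\<forall>x\<in>\<Omega>. transpose (A x) = A x)
      \<and> (\<exists>l>0. \<exists>L>0. \<forall>x\<in>\<Omega>. \<forall>\<xi>.
            l * (norm \<xi>)\<^sup>2 \<le> (A x *v \<xi>) \<bullet> \<xi> \<and> (A x *v \<xi>) \<bullet> \<xi> \<le> L * (norm \<xi>)\<^sup>2)"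

text \<open>Meant for elliptic \<open>A\<close>: the integrand is then integrable. The choice of the weak
  gradient does not matter, since it is unique up to null sets.\<close>

definition weak_solution ::
  "(real^'n) set \<Rightarrow> (real^'n \<Rightarrow> real^'n^'n) \<Rightarrow> (real^'n \<Rightarrow> real) \<Rightarrow> bool" where
  "weak_solution \<Omega> A u \<longleftrightarrow> u \<in> W1p_loc 1 \<Omega> \<and> (\<exists>Du. has_weak_gradient \<Omega> u Du
      \<and> (\<forall>\<phi>\<in>C1_c \<Omega>. (LINT x:\<Omega>|lebesgue. (A x *v Du x) \<bullet> grad \<phi> x) = 0))"

definition avg :: "'a::euclidean_space set \<Rightarrow> ('a \<Rightarrow> 'b::euclidean_space) \<Rightarrow> 'b" where
  "avg B f = (1 / measure lebesgue B) *\<^sub>R (LINT x:B|lebesgue. f x)"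

definition BMO :: "'a::euclidean_space set \<Rightarrow> ('a \<Rightarrow> 'b::euclidean_space) set" where
  "BMO U = {f. set_integrable lebesgue U f
      \<and> bdd_above {avg (ball c r) (\<lambda>x. norm (f x - avg (ball c r) f)) | c r.
                      0 < r \<and> ball c r \<subseteq> U}}"

definition BMO_loc :: "'a::euclidean_space set \<Rightarrow> ('a \<Rightarrow> 'b::euclidean_space) set" where
  "BMO_loc \<Omega> = {f. \<forall>c r. 0 < r \<and> compact (closure (ball c r)) \<and> closure (ball c r) \<subseteq> \<Omega>
                          \<longrightarrow> f \<in> BMO (ball c r)}"

end

theory Submission
  imports Defs
begin

text \<open>Fix a unit vector \<open>e\<close> and put \<open>u x = (x \<bullet> e) * (ell ((norm x)\<^sup>2))\<^sup>2\<close>, where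
  \<open>ell s = 16 - ln s\<close>. The gradient of \<open>u\<close> has a singularity of size \<open>(ln (norm x))\<^sup>2\<close> at the origin. All
  powers of a logarithm are locally integrable, so \<open>u\<close> lies in all local Sobolev spaces with finite exponent. But a function
  of bounded mean oscillation has averages over the balls of radius \<open>(1/2) ^ k\<close> that grow at most linearly
  in \<open>k\<close> (\<open>BMO_avg_dyadic_growth\<close>), whereas those of the gradient of \<open>u\<close> grow quadratically
  (\<open>profile_grad_avg_lower\<close>).

  It remains to find an equation that \<open>u\<close> satisfies. Away from the origin, let the matrix act as the
  identity in the radial direction and as multiplication by \<open>1 + anisotropy x\<close> in the tangential ones. As
  \<open>u\<close> is a first spherical harmonic times a radial function, the equation reduces to a formula for the
  anisotropy. Because the radial factor of \<open>u\<close> varies slowly on the logarithmic scale, the anisotropy is of order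
  \<open>1 / ln (norm x)\<close>; it tends to \<open>0\<close> at the origin, which makes the matrix continuous there
  (\<open>continuous_on_coefficient\<close>), and it is at least \<open>- 1/2\<close>, which makes it elliptic
  (\<open>elliptic_coefficient\<close>).

  The weak formulation has to take the singular point into account. Replacing the squared norm by
  \<open>x \<bullet> x + d\<close> with \<open>d > 0\<close> gives continuously differentiable versions of \<open>u\<close> and of the flux, the matrix
  applied to the gradient. The regularised flux remains exactly divergence free
  (\<open>flux_divergence_free\<close>), since it is built from an antisymmetric potential. Integration by parts
  against test functions (\<open>C1_c_integration_by_parts\<close>) is then elementary, and both identities pass to
  the limit by dominated convergence, the square of the singular weight being an integrable majorant
  (\<open>ell_dominated_limit\<close>).\<close>

section \<open>Integration by parts against test functions\<close>

lemma C1_c_outside: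
  assumes "\<phi> \<in> C1_c \<Omega>" "x \<notin> closure {x. \<phi> x \<noteq> 0}"
  shows "\<phi> x = 0" "grad \<phi> x = 0"
proof -
  let ?V = "- closure {x. \<phi> x \<noteq> 0}"
  have z: "\<phi> y = 0" if "y \<in> ?V" for y
    using that closure_subset[of "{x. \<phi> x \<noteq> 0}"] by auto
  show "\<phi> x = 0" using z assms(2) by blast
  have "((\<lambda>_. 0) has_derivative (\<lambda>h. 0)) (at x)" by simp
  then have "(\<phi> has_derivative (\<lambda>h. 0)) (at x)"
  proof (rule has_derivative_transform_within_open)
    show "open ?V" by blast
    show "x \<in> ?V" using assms(2) by blast
    show "0 = \<phi> y" if "y \<in> ?V" for y using z[OF that] by (rule sym)
  qed
  then have "GDERIV \<phi> x :> 0" unfolding gderiv_def by simp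
  then show "grad \<phi> x = 0" by (rule grad_eqI)
qed

lemma integrable_lebesgue_continuous_compact_support:
  fixes f :: "'a::euclidean_space \<Rightarrow> real"
  assumes "continuous_on UNIV f" "compact K" "\<And>x. x \<notin> K \<Longrightarrow> f x = 0"
  shows "integrable lebesgue f"
proof -
  have "integrable lborel (\<lambda>x. indicator K x *\<^sub>R f x)"
    by (rule borel_integrable_compact) (use assms continuous_on_subset[OF assms(1)] in auto)
  moreover have "(\<lambda>x. indicator K x *\<^sub>R f x) = f"
    using assms(3) by (auto simp: fun_eq_iff indicator_def)
  moreover have "f \<in> borel_measurable lborel"
    using assms(1) by (simp add: borel_measurable_continuous_onI)
  ultimately show ?thesis by (simp add: integrable_completion)
qed

lemma lebesgue_integral_translate:
  fixes f :: "'a::euclidean_space \<Rightarrow> real"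
  assumes "f \<in> borel_measurable borel"
  shows "(LINT x|lebesgue. f (x + a)) = (LINT x|lebesgue. f x)"
proof -
  have "(LINT x|lborel. f x) = (LINT x|distr lborel borel ((+) a). f x)"
    by (simp add: lborel_distr_plus)
  also have "\<dots> = (LINT x|lborel. f (x + a))"
    using assms by (subst integral_distr) (auto simp: add.commute)
  finally show ?thesis using assms by (simp add: integral_completion)
qed

lemma GDERIV_imp_continuous_on:
  assumes "\<And>x. GDERIV f x :> D x"
  shows "continuous_on UNIV f"
proof (rule has_derivative_continuous_on)
  show "(f has_derivative (\<lambda>h. h \<bullet> D x)) (at x within UNIV)" for x
    using assms[of x] by (simp add: gderiv_def)
qed

text \<open>This is where integration by parts comes from. The integral of \<open>w\<close> is
  invariant under translation, so every difference quotient of \<open>w\<close> in direction \<open>b\<close> has integral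
  \<open>0\<close>; the mean value theorem bounds the quotients uniformly on a bounded set that contains their
  supports, and dominated convergence passes to the derivative.\<close>
lemma integral_gradient_eq_0:
  fixes w :: "'a::euclidean_space \<Rightarrow> real"
  assumes D: "\<And>x. GDERIV w x :> D x" and contD: "continuous_on UNIV D"
    and K: "compact K" "\<And>x. x \<notin> K \<Longrightarrow> w x = 0"
  shows "(LINT x|lebesgue. D x \<bullet> b) = 0"
proof -
  have contw: "continuous_on UNIV w"
    using D by (rule GDERIV_imp_continuous_on)
  then have meas: "w \<in> borel_measurable borel" by (rule borel_measurable_continuous_onI)
  obtain R where R: "K \<subseteq> cball 0 R" using compact_imp_bounded[OF K(1)]
    by (auto simp: bounded_iff subset_eq)
  \<comment> \<open>\<open>C\<close> contains the supports of all quotients with steps at most \<open>1\<close>, as well as the segments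
    along which the mean value theorem is applied.\<close>
  define C where "C = cball (0::'a) (R + 2 * norm b)"
  have "bounded (D ` C)"
    unfolding C_def using contD by (intro compact_imp_bounded compact_continuous_image)
      (auto intro: continuous_on_subset)
  then obtain M where M: "\<And>x. x \<in> C \<Longrightarrow> norm (D x) \<le> M" by (auto simp: bounded_iff)
  define t where "t k = 1 / real (Suc k)" for k
  have t: "0 < t k" "t k \<le> 1" for k by (auto simp: t_def)
  define g where "g k x = (w (x + t k *\<^sub>R b) - w x) / t k" for k x
  have int_w: "integrable lebesgue (\<lambda>x. w x)"
    using integrable_lebesgue_continuous_compact_support[OF contw K] by simp
  have wtrans: "integrable lebesgue (\<lambda>x. w (x + a))" for a
  proof (rule integrable_lebesgue_continuous_compact_support)
    show "continuous_on UNIV (\<lambda>x. w (x + a))"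
      by (rule continuous_on_compose2[OF contw]) (auto intro!: continuous_intros)
    show "compact ((\<lambda>x. x - a) ` K)"
      by (rule compact_continuous_image) (auto intro!: continuous_intros K)
    show "w (x + a) = 0" if "x \<notin> (\<lambda>x. x - a) ` K" for x
      using that K(2)[of "x + a"] by (force simp: image_iff)
  qed
  have "(LINT x|lebesgue. g k x) = 0" for k
    using int_w wtrans lebesgue_integral_translate[OF meas] by (simp add: g_def)
  moreover have "(\<lambda>k. LINT x|lebesgue. g k x) \<longlonglongrightarrow> (LINT x|lebesgue. D x \<bullet> b)"
  proof (rule integral_dominated_convergence[where w="\<lambda>x. (M * norm b) * indicator C x"])
    show "(\<lambda>x. D x \<bullet> b) \<in> borel_measurable lebesgue"
      by (intro measurable_completion, simp, intro borel_measurable_continuous_onI continuous_intros contD)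
    show "g k \<in> borel_measurable lebesgue" for k
      unfolding g_def using int_w wtrans by auto
    show "integrable lebesgue (\<lambda>x. M * norm b * indicator C x)"
      unfolding C_def
      by (intro integrable_mult_right integrable_real_indicator) (use emeasure_lborel_cball_finite in auto)
    show "AE x in lebesgue. (\<lambda>k. g k x) \<longlonglongrightarrow> D x \<bullet> b"
    proof (rule AE_I2)
      fix x
      have "((\<lambda>s. x + s *\<^sub>R b) has_derivative (\<lambda>s. s *\<^sub>R b)) (at 0)"
        by (auto intro!: derivative_eq_intros)
      moreover have "(w has_derivative (\<lambda>h. h \<bullet> D x)) (at (x + 0 *\<^sub>R b))"
        using D[of x] by (simp add: gderiv_def)
      ultimately have "((\<lambda>s. w (x + s *\<^sub>R b)) has_derivative (\<lambda>s. (s *\<^sub>R b) \<bullet> D x)) (at 0)"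
        by (rule has_derivative_compose)
      then have "((\<lambda>s. w (x + s *\<^sub>R b)) has_real_derivative (D x \<bullet> b)) (at 0)"
        unfolding has_field_derivative_def by (simp add: inner_commute mult_commute_abs)
      then have "((\<lambda>s. (w (x + s *\<^sub>R b) - w x) / s) \<longlongrightarrow> D x \<bullet> b) (at 0)"
        by (simp add: has_field_derivative_iff)
      moreover have "filterlim t (at 0) sequentially"
        using LIMSEQ_inverse_real_of_nat less_imp_neq[OF t(1)]
        by (auto simp: filterlim_at t_def[abs_def] inverse_eq_divide)
      ultimately show "(\<lambda>k. g k x) \<longlonglongrightarrow> D x \<bullet> b"
        unfolding g_def by (rule filterlim_compose)
    qed
    show "AE x in lebesgue. norm (g k x) \<le> M * norm b * indicator C x" for k
    proof (rule AE_I2)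
      fix x
      have tb: "norm (t k *\<^sub>R b) \<le> norm b"
        using t[of k] by (simp add: mult_left_le_one_le)
      show "norm (g k x) \<le> M * norm b * indicator C x"
      proof (cases "x \<in> cball 0 (R + norm b)")
        case True
        then have xC: "x \<in> C" "x + t k *\<^sub>R b \<in> C"
          using tb norm_triangle_ineq[of x "t k *\<^sub>R b"] norm_ge_zero[of b]
          unfolding C_def mem_cball_0 by linarith+
        have "norm (w (x + t k *\<^sub>R b) - w x) \<le> M * norm (x + t k *\<^sub>R b - x)"
        proof (rule differentiable_bound[where S=C and f'="\<lambda>x h. h \<bullet> D x"])
          show "convex C" by (simp add: C_def)
          show "(w has_derivative (\<lambda>h. h \<bullet> D y)) (at y within C)" for y
            using D[of y] by (simp add: gderiv_def has_derivative_at_withinI)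
          show "onorm (\<lambda>h. h \<bullet> D y) \<le> M" if "y \<in> C" for y
          proof (rule onorm_le)
            fix h
            have "norm (h \<bullet> D y) \<le> norm h * norm (D y)" by (simp add: Cauchy_Schwarz_ineq2)
            also have "\<dots> \<le> norm h * M" using M[OF that] by (simp add: mult_left_mono)
            finally show "norm (h \<bullet> D y) \<le> M * norm h" by (simp add: mult.commute)
          qed
        qed (use xC in auto)
        then show ?thesis using t[of k] xC by (simp add: g_def field_simps)
      next
        case False
        have "norm x \<le> norm (x + t k *\<^sub>R b) + norm (t k *\<^sub>R b)"
          by (metis add_diff_cancel_right' norm_triangle_ineq4)
        then have "x \<notin> K" "x + t k *\<^sub>R b \<notin> K"
          using R False tb norm_ge_zero[of b] by (smt (verit) mem_cball_0 subsetD)+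
        moreover have "0 \<le> M * norm b * indicator C x"
        proof (cases "x \<in> C")
          case True
          then have "0 \<le> M" using M[of x] norm_ge_zero[of "D x"] by linarith
          then show ?thesis by simp
        qed simp
        ultimately show ?thesis by (simp add: g_def K(2))
      qed
    qed
  qed
  ultimately show ?thesis by (simp add: LIMSEQ_const_iff)
qed

lemma C1_c_integration_by_parts:
  fixes f :: "'a::euclidean_space \<Rightarrow> real"
  assumes \<phi>: "\<phi> \<in> C1_c \<Omega>" and D: "\<And>x. GDERIV f x :> f' x" and contD: "continuous_on UNIV f'"
  shows "set_integrable lebesgue \<Omega> (\<lambda>x. f x * (grad \<phi> x \<bullet> b))"
    and "set_integrable lebesgue \<Omega> (\<lambda>x. \<phi> x * (f' x \<bullet> b))"
    and "(LINT x:\<Omega>|lebesgue. f x * (grad \<phi> x \<bullet> b)) = - (LINT x:\<Omega>|lebesgue. \<phi> x * (f' x \<bullet> b))"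
proof -
  define K where "K = closure {x. \<phi> x \<noteq> 0}"
  have K: "compact K" "K \<subseteq> \<Omega>" and D\<phi>: "\<And>x. GDERIV \<phi> x :> grad \<phi> x"
    and cont: "continuous_on UNIV (grad \<phi>)"
    using \<phi> by (auto simp: C1_c_def K_def)
  note z = C1_c_outside[OF \<phi>, folded K_def]
  have cf: "continuous_on UNIV f" and c\<phi>: "continuous_on UNIV \<phi>"
    using GDERIV_imp_continuous_on D D\<phi> by blast+
  have ind: "indicator \<Omega> x *\<^sub>R (f x * (grad \<phi> x \<bullet> b)) = f x * (grad \<phi> x \<bullet> b)"
            "indicator \<Omega> x *\<^sub>R (\<phi> x * (f' x \<bullet> b)) = \<phi> x * (f' x \<bullet> b)" for x
    using z[of x] K(2) by (auto simp: indicator_def subset_eq)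
  have i1: "integrable lebesgue (\<lambda>x. f x * (grad \<phi> x \<bullet> b))"
    by (rule integrable_lebesgue_continuous_compact_support[OF _ K(1)],
        intro continuous_on_mult continuous_on_inner continuous_on_const cf cont) (simp add: z)
  have i2: "integrable lebesgue (\<lambda>x. \<phi> x * (f' x \<bullet> b))"
    by (rule integrable_lebesgue_continuous_compact_support[OF _ K(1)],
        intro continuous_on_mult continuous_on_inner continuous_on_const c\<phi> contD) (simp add: z)
  have "(LINT x|lebesgue. (f x *\<^sub>R grad \<phi> x + \<phi> x *\<^sub>R f' x) \<bullet> b) = 0"
  proof (rule integral_gradient_eq_0[OF GDERIV_mult[OF D D\<phi>] _ K(1)])
    show "continuous_on UNIV (\<lambda>x. f x *\<^sub>R grad \<phi> x + \<phi> x *\<^sub>R f' x)"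
      by (intro continuous_on_add continuous_on_scaleR cf cont c\<phi> contD)
  qed (simp add: z)
  then have "(LINT x|lebesgue. f x * (grad \<phi> x \<bullet> b)) + (LINT x|lebesgue. \<phi> x * (f' x \<bullet> b)) = 0"
    using i1 i2 by (simp add: inner_add_left)
  then show "(LINT x:\<Omega>|lebesgue. f x * (grad \<phi> x \<bullet> b)) = - (LINT x:\<Omega>|lebesgue. \<phi> x * (f' x \<bullet> b))"
    unfolding set_lebesgue_integral_def ind by simp
  show "set_integrable lebesgue \<Omega> (\<lambda>x. f x * (grad \<phi> x \<bullet> b))"
       "set_integrable lebesgue \<Omega> (\<lambda>x. \<phi> x * (f' x \<bullet> b))"
    using i1 i2 unfolding set_integrable_def ind by simp_all
qed

section \<open>Integrability of logarithmic singularities\<close>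

lemma dyadic_shell:
  fixes y :: real
  assumes "0 < y" "y < 1"
  obtains k where "(1/2) ^ Suc k \<le> y" "y < (1/2) ^ k"
proof -
  define m where "m = (LEAST m. (1/2::real) ^ m \<le> y)"
  obtain m0 where "(1/2::real) ^ m0 < y" using real_arch_pow_inv[of y "1/2"] assms(1) by (auto simp del: power_one_over)
  then have m: "(1/2::real) ^ m \<le> y" unfolding m_def
    by (rule LeastI[of "\<lambda>m. (1/2::real) ^ m \<le> y", OF less_imp_le])
  then have "m \<noteq> 0" using assms by (intro notI) simp
  then obtain k where k: "m = Suc k" by (cases m) auto
  have "\<not> (1/2::real) ^ k \<le> y" using not_less_Least[of k "\<lambda>m. (1/2::real) ^ m \<le> y"] k
    unfolding m_def by simp
  then show thesis using that[of k] m k by simp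
qed

text \<open>On the dyadic shell of outer radius \<open>(1/2) ^ k\<close> the integrand is at most
  \<open>2 powr (a * (k + 1))\<close>, while the surrounding ball has volume proportional to
  \<open>2 powr (- k * DIM('a))\<close>; the resulting series is geometric with ratio
  \<open>2 powr (a - DIM('a)) < 1\<close>.\<close>
lemma set_integrable_norm_powr:
  fixes a :: real
  assumes "0 \<le> a" "a < DIM('a::euclidean_space)"
  shows "set_integrable lebesgue (ball (0::'a) 1) (\<lambda>x. norm x powr (- a))"
proof -
  define V where "V = unit_ball_vol (DIM('a))"
  define q where "q = 2 powr (a - DIM('a))"
  have q: "0 < q" "q < 1" using assms using powr_less_mono[of "a - DIM('a)" 0 2] by (auto simp: q_def)
  define c where "c k = 2 powr (a * real (Suc k))" for k :: nat
  let ?B = "\<lambda>k. ball (0::'a) ((1/2) ^ k)"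
  have V: "V \<ge> 0" by (simp add: V_def)
  have pt: "ennreal (norm (indicator (ball 0 1) x *\<^sub>R norm x powr (- a)))
      \<le> (\<Sum>k. ennreal (c k) * indicator (?B k) x)" for x :: 'a
  proof (cases "x = 0 \<or> x \<notin> ball 0 1")
    case False
    then obtain k where k: "(1/2) ^ Suc k \<le> norm x" "norm x < (1/2) ^ k"
      using dyadic_shell[of "norm x"] by auto
    have "norm x powr (- a) \<le> ((1/2) ^ Suc k) powr (- a)"
      using k(1) assms by (intro powr_mono2') auto
    also have "\<dots> = c k"
      unfolding c_def by (simp add: powr_realpow[symmetric] powr_powr powr_minus_divide powr_divide
          algebra_simps del: power_Suc flip: powr_add)
    finally have "ennreal (norm (indicator (ball 0 1) x *\<^sub>R norm x powr (- a))) \<le> ennreal (c k)"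
      using False by (simp add: ennreal_leI)
    also have "\<dots> = (\<Sum>k\<in>{k}. ennreal (c k) * indicator (?B k) x)" using k by simp
    also have "\<dots> \<le> (\<Sum>k. ennreal (c k) * indicator (?B k) x)"
      by (rule sum_le_suminf) auto
    finally show ?thesis .
  qed auto
  have "(\<integral>\<^sup>+x. ennreal (norm (indicator (ball 0 1) (x::'a) *\<^sub>R norm x powr (- a))) \<partial>lborel)
      \<le> (\<integral>\<^sup>+x. (\<Sum>k. ennreal (c k) * indicator (?B k) x) \<partial>lborel)"
    by (rule nn_integral_mono) (rule pt)
  also have "\<dots> = (\<Sum>k. \<integral>\<^sup>+x. ennreal (c k) * indicator (?B k) x \<partial>lborel)"
    by (rule nn_integral_suminf) (auto intro!: borel_measurable_times_ennreal borel_measurable_indicator)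
  also have "\<dots> = (\<Sum>k. ennreal (c k * (V * ((1/2) ^ k) ^ DIM('a))))"
    using V by (simp add: nn_integral_cmult_indicator emeasure_ball V_def ennreal_mult c_def)
  also have "\<dots> = (\<Sum>k. ennreal (2 powr a * V * q ^ k))"
  proof (intro suminf_cong arg_cong[where f=ennreal])
    fix k
    have "((1/2::real) ^ k) ^ DIM('a) = 2 powr (- (real k * DIM('a)))"
      by (simp add: powr_minus_divide powr_realpow power_mult power_one_over flip: of_nat_mult)
    moreover have "q ^ k = 2 powr ((a - DIM('a)) * k)"
      by (simp add: q_def powr_powr flip: powr_realpow)
    ultimately have "c k * ((1/2) ^ k) ^ DIM('a) = 2 powr a * q ^ k"
      unfolding c_def by (simp add: algebra_simps flip: powr_add)
    then show "c k * (V * ((1/2) ^ k) ^ DIM('a)) = 2 powr a * V * q ^ k"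
      by (simp add: mult_ac)
  qed
  also have "\<dots> < \<infinity>"
  proof -
    have "summable (\<lambda>k. 2 powr a * V * q ^ k)"
      using q by (intro summable_mult summable_geometric) auto
    then show ?thesis using V q by (simp add: ennreal_suminf_neq_top less_top)
  qed
  finally have fin: "(\<integral>\<^sup>+x. ennreal (norm (indicator (ball 0 1) (x::'a) *\<^sub>R norm x powr (- a))) \<partial>lborel) < \<infinity>" .
  have meas: "(\<lambda>x. indicator (ball 0 1) (x::'a) *\<^sub>R norm x powr (- a)) \<in> borel_measurable lborel"
    by (intro borel_measurable_scaleR borel_measurable_indicator powr_real_measurable) auto
  show ?thesis
    unfolding set_integrable_def integrable_completion[OF meas] by (rule integrableI_bounded[OF meas fin])
qed

text \<open>Applied to the squared norm. The constant \<open>16\<close> keeps the weight large on the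
  unit ball, which makes the coefficient matrix below uniformly elliptic there and allows linear
  terms in the weight to be absorbed into quadratic ones.\<close>
definition ell :: "real \<Rightarrow> real" where "ell s = 16 - ln s"

lemma ell_ge: "0 < s \<Longrightarrow> s \<le> 2 \<Longrightarrow> 15 \<le> ell s"
  using ln_le_minus_one[of s] by (simp add: ell_def)

lemma ell_ge_16: "0 < s \<Longrightarrow> s \<le> 1 \<Longrightarrow> 16 \<le> ell s"
  by (simp add: ell_def)

lemma ell_antimono: "0 < s \<Longrightarrow> s \<le> t \<Longrightarrow> ell t \<le> ell s"
  by (simp add: ell_def)

lemma ell_le_powr:
  assumes "0 < d" "0 < s" "s \<le> 1"
  shows "ell s \<le> (16 + 1 / d) * s powr (- d)"
proof -
  have "ln (1 / s) \<le> (1 / s) powr d / d" using assms by (intro ln_powr_bound) auto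
  moreover have "(1 / s) powr d = s powr (- d)" using assms by (simp add: powr_divide powr_minus_divide)
  moreover have "1 \<le> s powr (- d)" using assms by (simp add: powr_minus_divide powr_le1)
  ultimately show ?thesis using assms by (simp add: ell_def ln_div algebra_simps)
qed

lemma borel_measurable_ell [measurable]: "ell \<in> borel_measurable borel"
  unfolding ell_def[abs_def] by measurable

text \<open>A power \<open>p\<close> of the weight costs only \<open>norm x powr (- 1/2)\<close> if
  \<open>ell_le_powr\<close> is used with \<open>d = 1 / (4 * p)\<close>; the exponent \<open>1/2\<close> is admissible in every dimension.\<close>
lemma set_integrable_ell_powr:
  assumes "0 < p"
  shows "set_integrable lebesgue (ball (0::'a::euclidean_space) 1) (\<lambda>x. ell ((norm x)\<^sup>2) powr p)"
proof -
  define C where "C = (16 + 1 / (1 / (4 * p))) powr p"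
  have "1/2 < real DIM('a)" using DIM_positive[where 'a='a] by linarith
  then have "set_integrable lebesgue (ball (0::'a) 1) (\<lambda>x. norm x powr (- (1/2)))"
    by (intro set_integrable_norm_powr) auto
  then have "set_integrable lebesgue (ball (0::'a) 1) (\<lambda>x. C * norm x powr (- (1/2)))"
    by (rule set_integrable_mult_right)
  then show ?thesis
  proof (rule set_integrable_bound)
    have "(\<lambda>x::'a. indicator (ball 0 1) x *\<^sub>R (ell ((norm x)\<^sup>2) powr p)) \<in> borel_measurable lborel"
      by (intro borel_measurable_scaleR borel_measurable_indicator powr_real_measurable
            measurable_compose[OF _ borel_measurable_ell]) auto
    then show "set_borel_measurable lebesgue (ball 0 1) (\<lambda>x::'a. ell ((norm x)\<^sup>2) powr p)"
      unfolding set_borel_measurable_def by (rule measurable_completion)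
    have "norm (ell ((norm x)\<^sup>2) powr p) \<le> norm (C * norm x powr (- (1/2)))"
      if "x \<in> ball 0 1" "x \<noteq> 0" for x :: 'a
    proof -
      let ?s = "(norm x)\<^sup>2"
      have s: "0 < ?s" "?s \<le> 1" using that by (auto simp: power_le_one)
      have "ell ?s powr p \<le> ((16 + 1 / (1 / (4 * p))) * ?s powr (- (1 / (4 * p)))) powr p"
        using assms s ell_ge_16[of ?s] by (intro powr_mono2 ell_le_powr) auto
      also have "\<dots> = C * (?s powr (- (1 / (4 * p)))) powr p"
        using assms by (simp add: powr_mult C_def)
      also have "(?s powr (- (1 / (4 * p)))) powr p = norm x powr (- (1/2))"
        using that assms by (simp add: powr_powr flip: powr_numeral)
      finally show ?thesis by simp
    qed
    then show "AE x in lebesgue. x \<in> ball 0 1 \<longrightarrow>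
        norm (ell ((norm x)\<^sup>2) powr p) \<le> norm (C * norm (x::'a) powr (- (1/2)))"
      using AE_completion[OF AE_lborel_singleton[of "0::'a"]] by (auto elim!: eventually_mono)
  qed
qed

lemma set_integrable_ell_bound:
  fixes f :: "'a::euclidean_space \<Rightarrow> 'b::euclidean_space"
  assumes "f \<in> borel_measurable lebesgue" "0 < p"
    and "\<And>x. norm x < 1 \<Longrightarrow> x \<noteq> 0 \<Longrightarrow> norm (f x) \<le> C * ell ((norm x)\<^sup>2) powr p"
  shows "set_integrable lebesgue (ball 0 1) f"
proof (rule set_integrable_bound)
  show "set_integrable lebesgue (ball 0 1) (\<lambda>x::'a. C * ell ((norm x)\<^sup>2) powr p)"
    using assms(2) by (intro set_integrable_mult_right set_integrable_ell_powr)
  show "set_borel_measurable lebesgue (ball 0 1) f"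
    unfolding set_borel_measurable_def using assms(1) by (intro borel_measurable_scaleR borel_measurable_indicator) auto
  show "AE x in lebesgue. x \<in> ball 0 1 \<longrightarrow> norm (f x) \<le> norm (C * ell ((norm x)\<^sup>2) powr p)"
    using AE_completion[OF AE_lborel_singleton[of "0::'a"]]
    by (rule eventually_mono) (use assms(3) in \<open>force intro: order_trans[OF _ abs_ge_self]\<close>)
qed

lemma Lp_loc_ell_bound:
  fixes f :: "'a::euclidean_space \<Rightarrow> 'b::euclidean_space"
  assumes f: "f \<in> borel_measurable borel" and p: "0 < p" and "0 \<le> C"
    and bound: "\<And>x. norm x < 1 \<Longrightarrow> x \<noteq> 0 \<Longrightarrow> norm (f x) \<le> C * (ell ((norm x)\<^sup>2))\<^sup>2"
  shows "f \<in> Lp_loc p (ball 0 1)"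
proof -
  have leb: "f \<in> borel_measurable lebesgue" using f by (intro measurable_completion) simp
  have "set_integrable lebesgue (ball 0 1) (\<lambda>x. norm (f x) powr p)"
  proof (rule set_integrable_ell_bound[where p="2 * p" and C="C powr p"])
    show "(\<lambda>x. norm (f x) powr p) \<in> borel_measurable lebesgue" using leb by measurable
    fix x :: 'a assume x: "norm x < 1" "x \<noteq> 0"
    then have "16 \<le> ell ((norm x)\<^sup>2)" by (intro ell_ge_16) (auto simp: power_le_one)
    then have e: "(ell ((norm x)\<^sup>2))\<^sup>2 powr p = ell ((norm x)\<^sup>2) powr (2 * p)"
      by (simp add: powr_powr flip: powr_numeral)
    have "norm (f x) powr p \<le> (C * (ell ((norm x)\<^sup>2))\<^sup>2) powr p"
      using p bound[OF x] by (intro powr_mono2) auto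
    then show "norm (norm (f x) powr p) \<le> C powr p * ell ((norm x)\<^sup>2) powr (2 * p)"
      using assms(3) by (simp add: powr_mult e)
  qed (use p in auto)
  then have "set_integrable lebesgue K (\<lambda>x. norm (f x) powr p)" if "compact K" "K \<subseteq> ball 0 1" for K
    by (rule set_integrable_subset) (use that in \<open>auto simp: compact_imp_closed\<close>)
  moreover have "f \<in> borel_measurable (lebesgue_on (ball 0 1))"
    using leb by (rule measurable_restrict_space1)
  ultimately show ?thesis by (simp add: Lp_loc_def)
qed

text \<open>The form of dominated convergence by which every identity for the regularised
  functions is carried over to the singular ones.\<close>
lemma ell_dominated_limit:
  fixes f :: "nat \<Rightarrow> 'a::euclidean_space \<Rightarrow> 'b::euclidean_space"
  assumes f: "\<And>k. f k \<in> borel_measurable lebesgue" and g: "g \<in> borel_measurable lebesgue"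
    and bound: "\<And>k x. norm x < 1 \<Longrightarrow> x \<noteq> 0 \<Longrightarrow> norm (f k x) \<le> C * (ell ((norm x)\<^sup>2))\<^sup>2"
    and lim: "\<And>x. norm x < 1 \<Longrightarrow> x \<noteq> 0 \<Longrightarrow> (\<lambda>k. f k x) \<longlonglongrightarrow> g x"
  shows "(\<lambda>k. LINT x:ball 0 1|lebesgue. f k x) \<longlonglongrightarrow> (LINT x:ball 0 1|lebesgue. g x)"
  unfolding set_lebesgue_integral_def
proof (rule integral_dominated_convergence)
  have AE: "AE x in lebesgue. x \<noteq> (0::'a)" by (rule AE_completion[OF AE_lborel_singleton])
  show "integrable lebesgue (\<lambda>x::'a. indicator (ball 0 1) x *\<^sub>R (C * (ell ((norm x)\<^sup>2)) powr 2))"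
    using set_integrable_ell_powr[of 2, where 'a='a]
    unfolding set_integrable_def[symmetric] by (intro set_integrable_mult_right) auto
  show "AE x in lebesgue. norm (indicator (ball 0 1) x *\<^sub>R f k x)
      \<le> indicator (ball 0 1) x *\<^sub>R (C * (ell ((norm x)\<^sup>2)) powr 2)" for k
    using AE
  proof (rule eventually_mono)
    fix x :: 'a assume x: "x \<noteq> 0"
    show "norm (indicator (ball 0 1) x *\<^sub>R f k x)
      \<le> indicator (ball 0 1) x *\<^sub>R (C * (ell ((norm x)\<^sup>2)) powr 2)"
    proof (cases "x \<in> ball 0 1")
      case True
      then have "16 \<le> ell ((norm x)\<^sup>2)" using x by (intro ell_ge_16) (auto simp: power_le_one)
      then show ?thesis using bound[of x k] True x by simp
    qed simp
  qed
  show "AE x in lebesgue. (\<lambda>k. indicator (ball 0 1) x *\<^sub>R f k x) \<longlonglongrightarrow> indicator (ball 0 1) x *\<^sub>R g x"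
    using AE
  proof (rule eventually_mono)
    fix x :: 'a assume "x \<noteq> 0"
    then show "(\<lambda>k. indicator (ball 0 1) x *\<^sub>R f k x) \<longlonglongrightarrow> indicator (ball 0 1) x *\<^sub>R g x"
      using lim[of x] by (cases "x \<in> ball 0 1") auto
  qed
qed (use f g in \<open>auto intro!: borel_measurable_scaleR borel_measurable_indicator\<close>)

section \<open>The regularised solution and its flux\<close>

lemma DERIV_ell: "0 < s \<Longrightarrow> DERIV ell s :> - (1 / s)"
  unfolding ell_def by (auto intro!: derivative_eq_intros)

text \<open>For \<open>d = 0\<close> this is the solution; for \<open>d > 0\<close> the singularity at the origin is
  smoothed out. The gradient and the flux below carry the same parameter.\<close>
definition profile :: "'a::euclidean_space \<Rightarrow> real \<Rightarrow> 'a \<Rightarrow> real" where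
  "profile e d x = (x \<bullet> e) * (ell (x \<bullet> x + d))\<^sup>2"

definition profile_grad :: "'a::euclidean_space \<Rightarrow> real \<Rightarrow> 'a \<Rightarrow> 'a" where
  "profile_grad e d x = (let s = x \<bullet> x + d in
     (ell s)\<^sup>2 *\<^sub>R e - (4 * ell s * (x \<bullet> e) / s) *\<^sub>R x)"

text \<open>This is twice the derivative of the radial potential
  \<open>G s = ((ell s)\<^sup>2 - 4 * ell s) / (n - 1)\<close>, on which the flux is built.\<close>
definition potential_slope :: "nat \<Rightarrow> real \<Rightarrow> real" where
  "potential_slope n s = (8 - 4 * ell s) / (s * (real n - 1))"

text \<open>The divergence, taken over the index \<open>i\<close>, of the antisymmetric matrix field with entries
  \<open>G (x \<bullet> x + d) * (x\<^sub>i * e\<^sub>j - x\<^sub>j * e\<^sub>i)\<close>. Antisymmetry is the reason why the flux is divergence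
  free, for every \<open>d\<close> and not just in the limit; the factor \<open>1 / (n - 1)\<close> in \<open>G\<close> and its linear term
  are chosen so that for \<open>d = 0\<close> the flux is the coefficient matrix applied to the gradient.\<close>
definition flux :: "'a::euclidean_space \<Rightarrow> real \<Rightarrow> 'a \<Rightarrow> 'a" where
  "flux e d x = (let s = x \<bullet> x + d; h = potential_slope DIM('a) s in
     ((ell s)\<^sup>2 - 4 * ell s + h * (x \<bullet> x)) *\<^sub>R e - (h * (x \<bullet> e)) *\<^sub>R x)"

lemma DERIV_potential_slope:
  assumes "0 < s" "2 \<le> n"
  shows "DERIV (potential_slope n) s :> (4 * ell s - 4) / (s\<^sup>2 * (real n - 1))"
proof -
  have "DERIV (\<lambda>s. (8 - 4 * ell s) * inverse s * (1 / (real n - 1))) s :>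
     ((- 4 * (- (1 / s))) * inverse s + (8 - 4 * ell s) * (- (inverse s ^ 2))) * (1 / (real n - 1))"
    using assms by (auto intro!: derivative_eq_intros DERIV_ell simp: power2_eq_square)
  moreover have "(\<lambda>s. (8 - 4 * ell s) * inverse s * (1 / (real n - 1))) = potential_slope n"
    by (simp add: potential_slope_def[abs_def] field_simps)
  moreover have "((- 4 * (- (1 / s))) * inverse s + (8 - 4 * ell s) * (- (inverse s ^ 2))) * (1 / (real n - 1))
     = (4 * ell s - 4) / (s\<^sup>2 * (real n - 1))"
    using assms by (simp add: field_simps power2_eq_square)
  ultimately show ?thesis by simp
qed

lemma GDERIV_inner_left: "GDERIV (\<lambda>x. x \<bullet> e) x :> e"
  unfolding gderiv_def by (auto intro!: derivative_eq_intros)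

lemma GDERIV_radial:
  assumes "DERIV g (x \<bullet> x + d) :> g'"
  shows "GDERIV (\<lambda>x. g (x \<bullet> x + d)) x :> (2 * g') *\<^sub>R x"
proof -
  have "GDERIV (\<lambda>x. x \<bullet> x + d) x :> 2 *\<^sub>R x"
    unfolding gderiv_def by (auto intro!: derivative_eq_intros simp: inner_commute)
  then have "GDERIV (\<lambda>x. g (x \<bullet> x + d)) x :> g' *\<^sub>R (2 *\<^sub>R x)"
    by (rule GDERIV_DERIV_compose) (rule assms)
  then show ?thesis by (simp add: mult.commute)
qed

lemma regularised_pos: "0 < d \<Longrightarrow> 0 < x \<bullet> x + d"
  by (simp add: add_nonneg_pos)

lemma regularised_nonzero: "0 < d \<Longrightarrow> x \<bullet> x + d \<noteq> 0"
  using regularised_pos[of d x] by simp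

lemma GDERIV_profile:
  assumes "0 < d"
  shows "GDERIV (profile e d) x :> profile_grad e d x"
proof -
  let ?s = "x \<bullet> x + d"
  have s: "0 < ?s" using assms by (rule regularised_pos)
  have "DERIV (\<lambda>s. (ell s)\<^sup>2) ?s :> 2 * ell ?s * (- (1 / ?s))"
    using DERIV_ell[OF s] by (auto intro!: derivative_eq_intros)
  from GDERIV_mult[OF GDERIV_inner_left GDERIV_radial[OF this]]
  show ?thesis
    unfolding profile_def[abs_def] profile_grad_def Let_def
    by (rule GDERIV_subst) (simp add: algebra_simps)
qed

lemma continuous_on_ell_regularised:
  assumes "0 < d"
  shows "continuous_on UNIV (\<lambda>x. ell (x \<bullet> x + d))"
  unfolding ell_def using regularised_nonzero[OF assms] by (intro continuous_intros) auto

lemma continuous_on_profile_grad: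
  assumes "0 < d"
  shows "continuous_on UNIV (profile_grad e d)"
  unfolding profile_grad_def[abs_def] Let_def
  by (intro continuous_on_diff continuous_on_scaleR continuous_on_power continuous_on_divide continuous_on_mult
      continuous_on_inner continuous_on_add continuous_on_const continuous_on_id
      continuous_on_ell_regularised ballI regularised_nonzero assms)

lemma profile_by_parts:
  assumes "0 < d" "\<phi> \<in> C1_c \<Omega>"
  shows "(LINT x:\<Omega>|lebesgue. profile e d x * (grad \<phi> x \<bullet> b)) =
       - (LINT x:\<Omega>|lebesgue. \<phi> x * (profile_grad e d x \<bullet> b))"
  by (rule C1_c_integration_by_parts(3)[OF assms(2) GDERIV_profile[OF assms(1)]
        continuous_on_profile_grad[OF assms(1)]])

lemma integral_diff_sum:
  fixes f :: "'x \<Rightarrow> real"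
  assumes "integrable M f" "\<And>b. integrable M (g b)"
  shows "(LINT x|M. f x - (\<Sum>b\<in>B. g b x)) = (LINT x|M. f x) - (\<Sum>b\<in>B. LINT x|M. g b x)"
  using assms by (simp add: Bochner_Integration.integral_sum Bochner_Integration.integrable_sum)

text \<open>The divergence of the flux is \<open>f' x \<bullet> e - (\<Sum>b\<in>Basis. g' b x \<bullet> b)\<close> in the notation of the
  proof. It vanishes because \<open>ell\<close> has derivative \<open>- 1 / s\<close>, so that the derivative of
  \<open>(ell s)\<^sup>2 - 4 * ell s\<close> is \<open>(n - 1) / 2\<close> times the potential slope; the terms with the derivative of
  the slope cancel by themselves.\<close>
lemma flux_divergence_free:
  fixes e :: "'a::euclidean_space"
  assumes d: "0 < d" and n: "2 \<le> DIM('a)" and \<phi>: "\<phi> \<in> C1_c \<Omega>"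
  shows "(LINT x:\<Omega>|lebesgue. flux e d x \<bullet> grad \<phi> x) = 0"
proof -
  define h where "h x = potential_slope DIM('a) (x \<bullet> x + d)" for x :: 'a
  define dh where "dh x = (4 * ell (x \<bullet> x + d) - 4) / ((x \<bullet> x + d)\<^sup>2 * (real DIM('a) - 1))" for x :: 'a
  define f where "f x = (ell (x \<bullet> x + d))\<^sup>2 - 4 * ell (x \<bullet> x + d) + h x * (x \<bullet> x)" for x :: 'a
  define f' where "f' x = ((8 - 4 * ell (x \<bullet> x + d)) / (x \<bullet> x + d) + 2 * dh x * (x \<bullet> x) + 2 * h x) *\<^sub>R x" for x
  define g where "g b x = h x * (x \<bullet> e) * (x \<bullet> b)" for b x
  define g' where "g' b x = (h x * (x \<bullet> e)) *\<^sub>R b + (x \<bullet> b) *\<^sub>R (h x *\<^sub>R e + (x \<bullet> e) *\<^sub>R ((2 * dh x) *\<^sub>R x))" for b x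
  have nz: "x \<bullet> x + d \<noteq> 0" for x :: 'a using d by (rule regularised_nonzero)
  have n1: "real DIM('a) - 1 \<noteq> 0" using n by linarith
  have Dh: "GDERIV h x :> (2 * dh x) *\<^sub>R x" for x
    unfolding h_def[abs_def] dh_def
    by (rule GDERIV_radial) (rule DERIV_potential_slope[OF regularised_pos[OF d] n])
  have Df: "GDERIV f x :> f' x" for x
  proof -
    have s: "0 < x \<bullet> x + d" using d by (rule regularised_pos)
    have 1: "DERIV (\<lambda>s. (ell s)\<^sup>2 - 4 * ell s) (x \<bullet> x + d) :> (4 - 2 * ell (x \<bullet> x + d)) / (x \<bullet> x + d)"
      using DERIV_ell[OF s] by (auto intro!: derivative_eq_intros simp: diff_divide_distrib)
    have 2: "GDERIV (\<lambda>x. x \<bullet> x) x :> 2 *\<^sub>R x"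
      unfolding gderiv_def by (auto intro!: derivative_eq_intros simp: inner_commute)
    from GDERIV_add[OF GDERIV_radial[OF 1] GDERIV_mult[OF Dh 2]]
    show ?thesis unfolding f_def[abs_def] f'_def
      by (rule GDERIV_subst) (simp add: algebra_simps)
  qed
  have Dg: "GDERIV (g b) x :> g' b x" for b x
    unfolding g_def[abs_def] g'_def
    by (rule GDERIV_mult[OF GDERIV_mult[OF Dh GDERIV_inner_left] GDERIV_inner_left])
  note cell = continuous_on_ell_regularised[OF d, where 'a='a]
  have ch: "continuous_on UNIV h" by (rule GDERIV_imp_continuous_on) (rule Dh)
  have cdh: "continuous_on UNIV dh" unfolding dh_def[abs_def]
    using nz n1 by (intro continuous_on_divide continuous_on_diff continuous_on_mult continuous_on_power
      continuous_on_inner continuous_on_add continuous_on_const continuous_on_id cell) auto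
  have cf': "continuous_on UNIV f'" unfolding f'_def[abs_def]
    by (intro continuous_on_scaleR continuous_on_divide continuous_on_diff continuous_on_mult
      continuous_on_inner continuous_on_add continuous_on_const continuous_on_id cell cdh ch ballI nz)
  have cg': "continuous_on UNIV (g' b)" for b unfolding g'_def[abs_def]
    by (intro continuous_on_scaleR continuous_on_mult
      continuous_on_inner continuous_on_add continuous_on_const continuous_on_id cdh ch)
  note F = C1_c_integration_by_parts[OF \<phi> Df cf', of e]
  note G = C1_c_integration_by_parts[OF \<phi> Dg cg', of b b for b]
  have pt1: "flux e d x \<bullet> v = f x * (v \<bullet> e) - (\<Sum>b\<in>Basis. g b x * (v \<bullet> b))" for x v
  proof -
    have "flux e d x \<bullet> v = f x * (v \<bullet> e) - h x * (x \<bullet> e) * (x \<bullet> v)"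
      by (simp add: flux_def Let_def f_def h_def inner_diff_left inner_commute[of e v])
    also have "h x * (x \<bullet> e) * (x \<bullet> v) = (\<Sum>b\<in>Basis. g b x * (v \<bullet> b))"
      unfolding g_def euclidean_inner[of x v] by (simp add: sum_distrib_left mult.assoc)
    finally show ?thesis .
  qed
  have pt2: "\<phi> x * (f' x \<bullet> e) - (\<Sum>b\<in>Basis. \<phi> x * (g' b x \<bullet> b)) = 0" for x
  proof -
    have "(\<Sum>b\<in>Basis. g' b x \<bullet> b) =
       (\<Sum>b\<in>Basis. h x * (x \<bullet> e) + h x * ((x \<bullet> b) * (e \<bullet> b)) + 2 * dh x * (x \<bullet> e) * ((x \<bullet> b) * (x \<bullet> b)))"
      by (intro sum.cong) (auto simp: g'_def inner_add_left algebra_simps)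
    also have "\<dots> = real DIM('a) * (h x * (x \<bullet> e)) + h x * (x \<bullet> e) + 2 * dh x * (x \<bullet> e) * (x \<bullet> x)"
      by (simp add: sum.distrib sum_distrib_left[symmetric] euclidean_inner[symmetric])
    also have "\<dots> = f' x \<bullet> e"
    proof -
      have "(8 - 4 * ell (x \<bullet> x + d)) / (x \<bullet> x + d) = (real DIM('a) - 1) * h x"
        using nz[of x] n1 by (simp add: h_def potential_slope_def)
      then show ?thesis unfolding f'_def by (simp only:) (simp add: algebra_simps)
    qed
    finally show ?thesis by (simp add: sum_distrib_left[symmetric])
  qed
  have iG: "integrable lebesgue (\<lambda>x. indicator \<Omega> x *\<^sub>R (g b x * (grad \<phi> x \<bullet> b)))"
           "integrable lebesgue (\<lambda>x. indicator \<Omega> x *\<^sub>R (\<phi> x * (g' b x \<bullet> b)))" for b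
    using G(1,2)[of b] by (simp_all only: set_integrable_def)
  have iF: "integrable lebesgue (\<lambda>x. indicator \<Omega> x *\<^sub>R (f x * (grad \<phi> x \<bullet> e)))"
           "integrable lebesgue (\<lambda>x. indicator \<Omega> x *\<^sub>R (\<phi> x * (f' x \<bullet> e)))"
    using F(1,2) by (simp_all only: set_integrable_def)
  have "(LINT x:\<Omega>|lebesgue. flux e d x \<bullet> grad \<phi> x)
      = (LINT x:\<Omega>|lebesgue. f x * (grad \<phi> x \<bullet> e)) - (\<Sum>b\<in>Basis. LINT x:\<Omega>|lebesgue. g b x * (grad \<phi> x \<bullet> b))"
    unfolding set_lebesgue_integral_def pt1 scaleR_diff_right scaleR_sum_right
    by (rule integral_diff_sum[OF iF(1) iG(1)])
  also have "\<dots> = - ((LINT x:\<Omega>|lebesgue. \<phi> x * (f' x \<bullet> e)) - (\<Sum>b\<in>Basis. LINT x:\<Omega>|lebesgue. \<phi> x * (g' b x \<bullet> b)))"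
    unfolding F(3) G(3) by (simp add: sum_negf)
  also have "(LINT x:\<Omega>|lebesgue. \<phi> x * (f' x \<bullet> e)) - (\<Sum>b\<in>Basis. LINT x:\<Omega>|lebesgue. \<phi> x * (g' b x \<bullet> b))
      = (LINT x:\<Omega>|lebesgue. \<phi> x * (f' x \<bullet> e) - (\<Sum>b\<in>Basis. \<phi> x * (g' b x \<bullet> b)))"
    unfolding set_lebesgue_integral_def scaleR_diff_right scaleR_sum_right
    by (rule integral_diff_sum[OF iF(2) iG(2), symmetric])
  finally show ?thesis by (simp add: pt2)
qed

section \<open>Removal of the regularisation\<close>

lemma C1_c_bounded:
  assumes "\<phi> \<in> C1_c \<Omega>"
  obtains M where "0 \<le> M" "\<And>x. \<bar>\<phi> x\<bar> \<le> M" "\<And>x. norm (grad \<phi> x) \<le> M"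
proof -
  define K where "K = closure {x. \<phi> x \<noteq> 0}"
  have K: "compact K" and cont: "continuous_on UNIV (grad \<phi>)" and "continuous_on UNIV \<phi>"
    using assms GDERIV_imp_continuous_on[of \<phi> "grad \<phi>"] by (auto simp: C1_c_def K_def)
  then have "bounded (\<phi> ` K)" "bounded (grad \<phi> ` K)"
    by (auto intro!: compact_imp_bounded compact_continuous_image intro: continuous_on_subset)
  then obtain a b where ab: "\<And>x. x \<in> K \<Longrightarrow> \<bar>\<phi> x\<bar> \<le> a" "\<And>x. x \<in> K \<Longrightarrow> norm (grad \<phi> x) \<le> b"
    by (auto simp: bounded_iff)
  note z = C1_c_outside[OF assms, folded K_def]
  show thesis
  proof (rule that[of "max 0 (max a b)"])
    fix x
    show "\<bar>\<phi> x\<bar> \<le> max 0 (max a b)" using ab(1)[of x] z(1)[of x] by (cases "x \<in> K") auto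
    show "norm (grad \<phi> x) \<le> max 0 (max a b)" using ab(2)[of x] z(2)[of x] by (cases "x \<in> K") auto
  qed simp
qed

lemma C1_c_measurable:
  assumes "\<phi> \<in> C1_c \<Omega>"
  shows "\<phi> \<in> borel_measurable borel" "grad \<phi> \<in> borel_measurable borel"
  using assms GDERIV_imp_continuous_on[of \<phi> "grad \<phi>"]
  by (auto simp: C1_c_def intro!: borel_measurable_continuous_onI)

lemma profile_measurable: "profile e d \<in> borel_measurable borel"
  unfolding profile_def[abs_def] by measurable

lemma profile_grad_measurable: "profile_grad e d \<in> borel_measurable borel"
  unfolding profile_grad_def[abs_def] Let_def by measurable

lemma flux_measurable: "flux e d \<in> borel_measurable borel"
  unfolding flux_def[abs_def] Let_def potential_slope_def by measurable

lemma inner_scaleR_regularised_le: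
  fixes x e :: "'a::euclidean_space"
  assumes "norm e = 1" "0 \<le> d" "x \<noteq> 0"
  shows "norm ((x \<bullet> e) *\<^sub>R x) \<le> x \<bullet> x + d"
proof -
  have "\<bar>x \<bullet> e\<bar> \<le> norm x" using Cauchy_Schwarz_ineq2[of x e] assms by simp
  then have "\<bar>x \<bullet> e\<bar> * norm x \<le> norm x * norm x" by (rule mult_right_mono) simp
  also have "\<dots> = x \<bullet> x" by (simp add: power2_norm_eq_inner flip: power2_eq_square)
  finally show ?thesis using assms by simp
qed

text \<open>Regularising makes the weight smaller, so that the bounds below are uniform in
  \<open>d\<close> and the singular weight dominates all of them.\<close>
lemma regularised_ell_bounds:
  fixes x :: "'a::euclidean_space"
  assumes "0 \<le> d" "d \<le> 1" "norm x < 1" "x \<noteq> 0"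
  shows "0 < x \<bullet> x + d" "15 \<le> ell (x \<bullet> x + d)" "ell (x \<bullet> x + d) \<le> ell ((norm x)\<^sup>2)"
proof -
  have x: "x \<bullet> x = (norm x)\<^sup>2" by (simp add: power2_norm_eq_inner)
  have "0 < x \<bullet> x" "x \<bullet> x \<le> 1" using assms by (auto simp: x power_le_one)
  then have "0 < x \<bullet> x + d" "x \<bullet> x \<le> x \<bullet> x + d" "x \<bullet> x + d \<le> 2" using assms by linarith+
  with \<open>0 < x \<bullet> x\<close> show "0 < x \<bullet> x + d" "15 \<le> ell (x \<bullet> x + d)" "ell (x \<bullet> x + d) \<le> ell ((norm x)\<^sup>2)"
    unfolding x[symmetric] by (auto intro!: ell_ge ell_antimono)
qed

lemma profile_bound:
  assumes "norm e = 1" "0 \<le> d" "d \<le> 1" "norm x < 1" "x \<noteq> 0"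
  shows "\<bar>profile e d x\<bar> \<le> 2 * (ell ((norm x)\<^sup>2))\<^sup>2"
proof -
  note b = regularised_ell_bounds[OF assms(2-5)]
  have "\<bar>x \<bullet> e\<bar> \<le> 1" using Cauchy_Schwarz_ineq2[of x e] assms by simp
  then have "\<bar>profile e d x\<bar> \<le> 1 * (ell (x \<bullet> x + d))\<^sup>2"
    unfolding profile_def abs_mult by (intro mult_mono) auto
  also have "\<dots> \<le> (ell ((norm x)\<^sup>2))\<^sup>2" using b by (simp add: power_mono)
  finally show ?thesis using zero_le_power2[of "ell ((norm x)\<^sup>2)"] by linarith
qed

lemma profile_grad_bound:
  assumes "norm e = 1" "0 \<le> d" "d \<le> 1" "norm x < 1" "x \<noteq> 0"
  shows "norm (profile_grad e d x) \<le> 2 * (ell ((norm x)\<^sup>2))\<^sup>2"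
proof -
  let ?s = "x \<bullet> x + d"
  note b = regularised_ell_bounds[OF assms(2-5)]
  have "norm ((4 * ell ?s * (x \<bullet> e) / ?s) *\<^sub>R x) = (4 * ell ?s / ?s) * norm ((x \<bullet> e) *\<^sub>R x)"
    using b by (simp add: abs_mult)
  also have "\<dots> \<le> (4 * ell ?s / ?s) * ?s"
    using b inner_scaleR_regularised_le[OF assms(1,2,5)] by (intro mult_left_mono) auto
  also have "\<dots> = 4 * ell ?s" using b by simp
  finally have "norm (profile_grad e d x) \<le> (ell ?s)\<^sup>2 + 4 * ell ?s"
    unfolding profile_grad_def Let_def
    using norm_triangle_ineq4[of "(ell ?s)\<^sup>2 *\<^sub>R e" "(4 * ell ?s * (x \<bullet> e) / ?s) *\<^sub>R x"] assms(1) by simp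
  also have "\<dots> \<le> 2 * (ell ?s)\<^sup>2" using b mult_right_mono[of 4 "ell ?s" "ell ?s"] by (simp add: power2_eq_square)
  also have "\<dots> \<le> 2 * (ell ((norm x)\<^sup>2))\<^sup>2" using b by (simp add: power_mono)
  finally show ?thesis .
qed

lemma flux_bound:
  fixes e x :: "'a::euclidean_space"
  assumes "norm e = 1" "0 \<le> d" "d \<le> 1" "norm x < 1" "x \<noteq> 0" and n: "2 \<le> DIM('a)"
  shows "norm (flux e d x) \<le> 2 * (ell ((norm x)\<^sup>2))\<^sup>2"
proof -
  define s where "s = x \<bullet> x + d"
  define h where "h = potential_slope DIM('a) s"
  note b = regularised_ell_bounds[OF assms(2-5), folded s_def]
  have h: "\<bar>h\<bar> * s \<le> 4 * ell s"
  proof -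
    have "\<bar>h\<bar> * s = (4 * ell s - 8) / (real DIM('a) - 1)"
      using b n by (simp add: h_def potential_slope_def abs_mult)
    also have "\<dots> \<le> (4 * ell s - 8) / 1" using n b by (intro divide_left_mono) auto
    finally show ?thesis by simp
  qed
  have "\<bar>h * (x \<bullet> x)\<bar> \<le> \<bar>h\<bar> * s" using assms by (auto simp: abs_mult s_def intro!: mult_left_mono)
  then have h1: "\<bar>h * (x \<bullet> x)\<bar> \<le> 4 * ell s" using h by simp
  have "norm ((h * (x \<bullet> e)) *\<^sub>R x) = \<bar>h\<bar> * norm ((x \<bullet> e) *\<^sub>R x)" by (simp add: abs_mult)
  also have "\<dots> \<le> \<bar>h\<bar> * s"
    using inner_scaleR_regularised_le[OF assms(1,2,5)] by (intro mult_left_mono) (auto simp: s_def)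
  finally have h2: "norm ((h * (x \<bullet> e)) *\<^sub>R x) \<le> 4 * ell s" using h by simp
  have sq: "4 * ell s \<le> (ell s)\<^sup>2"
    using b unfolding power2_eq_square by (intro mult_right_mono) auto
  have "norm (flux e d x) \<le> norm (((ell s)\<^sup>2 - 4 * ell s + h * (x \<bullet> x)) *\<^sub>R e) + norm ((h * (x \<bullet> e)) *\<^sub>R x)"
    unfolding flux_def Let_def s_def h_def by (rule norm_triangle_ineq4)
  also have "\<dots> \<le> (\<bar>(ell s)\<^sup>2 - 4 * ell s\<bar> + \<bar>h * (x \<bullet> x)\<bar>) + 4 * ell s"
    using h2 assms(1) abs_triangle_ineq[of "(ell s)\<^sup>2 - 4 * ell s" "h * (x \<bullet> x)"] by simp
  also have "\<bar>(ell s)\<^sup>2 - 4 * ell s\<bar> = (ell s)\<^sup>2 - 4 * ell s"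
    using sq by simp
  also have "((ell s)\<^sup>2 - 4 * ell s + \<bar>h * (x \<bullet> x)\<bar>) + 4 * ell s \<le> 2 * (ell s)\<^sup>2"
    using h1 sq by simp
  also have "\<dots> \<le> 2 * (ell ((norm x)\<^sup>2))\<^sup>2" using b by (simp add: power_mono)
  finally show ?thesis .
qed

lemma tendsto_regularised:
  fixes x e :: "'a::euclidean_space"
  assumes d: "d \<longlonglongrightarrow> 0" and x: "x \<noteq> 0"
  shows "(\<lambda>k. profile e (d k) x) \<longlonglongrightarrow> profile e 0 x"
    and "(\<lambda>k. profile_grad e (d k) x) \<longlonglongrightarrow> profile_grad e 0 x"
    and "2 \<le> DIM('a) \<Longrightarrow> (\<lambda>k. flux e (d k) x) \<longlonglongrightarrow> flux e 0 x"
proof -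
  have s: "(\<lambda>k. x \<bullet> x + d k) \<longlonglongrightarrow> x \<bullet> x + 0" by (intro tendsto_intros d)
  have nz: "x \<bullet> x + 0 \<noteq> 0" using x by simp
  have l: "(\<lambda>k. ell (x \<bullet> x + d k)) \<longlonglongrightarrow> ell (x \<bullet> x + 0)"
    unfolding ell_def by (intro tendsto_intros s nz)
  show "(\<lambda>k. profile e (d k) x) \<longlonglongrightarrow> profile e 0 x"
    unfolding profile_def by (intro tendsto_intros l)
  show "(\<lambda>k. profile_grad e (d k) x) \<longlonglongrightarrow> profile_grad e 0 x"
    unfolding profile_grad_def Let_def by (intro tendsto_intros l s nz)
  assume "2 \<le> DIM('a)"
  then have "(x \<bullet> x + 0) * (real DIM('a) - 1) \<noteq> 0" using nz by auto
  then show "(\<lambda>k. flux e (d k) x) \<longlonglongrightarrow> flux e 0 x"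
    unfolding flux_def Let_def potential_slope_def by (intro tendsto_intros l s)
qed

definition shrink :: "nat \<Rightarrow> real" where "shrink k = 1 / real (Suc k)"

lemma shrink: "0 < shrink k" "shrink k \<le> 1" "shrink \<longlonglongrightarrow> 0"
  using LIMSEQ_inverse_real_of_nat by (auto simp: shrink_def[abs_def] inverse_eq_divide)

text \<open>Integration by parts holds for each regularised function, and both sides converge. The
  integrability is needed to assemble the coordinatewise identities into one between vectors.\<close>
lemma profile_has_weak_gradient:
  fixes e :: "'a::euclidean_space"
  assumes e: "norm e = 1"
  shows "has_weak_gradient (ball 0 1) (profile e 0) (profile_grad e 0)"
  unfolding has_weak_gradient_def
proof (intro conjI ballI)
  show "profile e 0 \<in> Lp_loc 1 (ball 0 1)"
    by (rule Lp_loc_ell_bound[where C=2]) (use profile_measurable profile_bound[OF e, of 0] in auto)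
  show "profile_grad e 0 \<in> Lp_loc 1 (ball 0 1)"
    by (rule Lp_loc_ell_bound[where C=2]) (use profile_grad_measurable profile_grad_bound[OF e, of 0] in auto)
  fix \<phi> assume \<phi>: "\<phi> \<in> C1_c (ball (0::'a) 1)"
  obtain M where M: "0 \<le> M" "\<And>x. \<bar>\<phi> x\<bar> \<le> M" "\<And>x. norm (grad \<phi> x) \<le> M" using C1_c_bounded[OF \<phi>] by blast
  note [measurable] = C1_c_measurable[OF \<phi>] profile_measurable profile_grad_measurable
  have bd1: "norm (profile e d x *\<^sub>R grad \<phi> x) \<le> (2 * M) * (ell ((norm x)\<^sup>2))\<^sup>2"
    if "0 \<le> d" "d \<le> 1" "norm x < 1" "x \<noteq> 0" for d x
    using mult_mono[OF profile_bound[OF e that] M(3)[of x]] by (simp add: mult_ac)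
  have bd2: "norm (\<phi> x *\<^sub>R profile_grad e d x) \<le> (2 * M) * (ell ((norm x)\<^sup>2))\<^sup>2"
    if "0 \<le> d" "d \<le> 1" "norm x < 1" "x \<noteq> 0" for d x
    using mult_mono[OF M(2)[of x] profile_grad_bound[OF e that]] M(1) by (simp add: mult_ac)
  have m1: "(\<lambda>x. profile e d x *\<^sub>R grad \<phi> x) \<in> borel_measurable lebesgue" for d
    by (rule measurable_completion) measurable
  have m2: "(\<lambda>x. \<phi> x *\<^sub>R profile_grad e d x) \<in> borel_measurable lebesgue" for d
    by (rule measurable_completion) measurable
  have i1: "set_integrable lebesgue (ball 0 1) (\<lambda>x. profile e d x *\<^sub>R grad \<phi> x)"
    and i2: "set_integrable lebesgue (ball 0 1) (\<lambda>x. \<phi> x *\<^sub>R profile_grad e d x)"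
    if "0 \<le> d" "d \<le> 1" for d
  proof -
    have pw: "y powr 2 = y\<^sup>2" if "0 \<le> y" for y :: real
      using that by (cases "y = 0") auto
    have p: "(ell ((norm x)\<^sup>2))\<^sup>2 = ell ((norm x)\<^sup>2) powr 2" if "norm x < 1" "x \<noteq> 0" for x :: 'a
      using ell_ge_16[of "(norm x)\<^sup>2"] that by (subst pw) (auto simp: power_le_one)
    show "set_integrable lebesgue (ball 0 1) (\<lambda>x. profile e d x *\<^sub>R grad \<phi> x)"
      by (rule set_integrable_ell_bound[OF m1, of 2 _ "2 * M"]) (use bd1 that p in auto)
    show "set_integrable lebesgue (ball 0 1) (\<lambda>x. \<phi> x *\<^sub>R profile_grad e d x)"
      by (rule set_integrable_ell_bound[OF m2, of 2 _ "2 * M"]) (use bd2 that p in auto)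
  qed
  have eq: "(LINT x:ball 0 1|lebesgue. profile e (shrink k) x *\<^sub>R grad \<phi> x) =
      - (LINT x:ball 0 1|lebesgue. \<phi> x *\<^sub>R profile_grad e (shrink k) x)" for k
  proof (rule euclidean_eqI)
    fix b :: 'a
    have d: "0 \<le> shrink k" "shrink k \<le> 1" using shrink(1,2)[of k] by auto
    show "(LINT x:ball 0 1|lebesgue. profile e (shrink k) x *\<^sub>R grad \<phi> x) \<bullet> b =
      - (LINT x:ball 0 1|lebesgue. \<phi> x *\<^sub>R profile_grad e (shrink k) x) \<bullet> b"
      using profile_by_parts[OF shrink(1)[of k] \<phi>, of e b] i1[OF d] i2[OF d]
      unfolding set_lebesgue_integral_def set_integrable_def
      by (simp add: mult.assoc flip: integral_inner_left)
  qed
  have "(\<lambda>k. LINT x:ball 0 1|lebesgue. profile e (shrink k) x *\<^sub>R grad \<phi> x)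
      \<longlonglongrightarrow> (LINT x:ball 0 1|lebesgue. profile e 0 x *\<^sub>R grad \<phi> x)"
    by (rule ell_dominated_limit[OF m1 m1, where C="2 * M"])
      (erule (1) bd1[OF less_imp_le[OF shrink(1)] shrink(2)],
        intro tendsto_scaleR tendsto_const tendsto_regularised shrink(3))
  moreover have "(\<lambda>k. - (LINT x:ball 0 1|lebesgue. \<phi> x *\<^sub>R profile_grad e (shrink k) x))
      \<longlonglongrightarrow> - (LINT x:ball 0 1|lebesgue. \<phi> x *\<^sub>R profile_grad e 0 x)"
    by (rule tendsto_minus, rule ell_dominated_limit[OF m2 m2, where C="2 * M"])
      (erule (1) bd2[OF less_imp_le[OF shrink(1)] shrink(2)],
        intro tendsto_scaleR tendsto_const tendsto_regularised shrink(3))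
  ultimately show "(LINT x:ball 0 1|lebesgue. profile e 0 x *\<^sub>R grad \<phi> x) =
      - (LINT x:ball 0 1|lebesgue. \<phi> x *\<^sub>R profile_grad e 0 x)"
    unfolding eq by (rule LIMSEQ_unique)
qed

lemma profile_in_W1p_loc:
  assumes e: "norm e = 1" and "0 < p"
  shows "profile e 0 \<in> W1p_loc p (ball 0 1)"
proof -
  have "profile e 0 \<in> Lp_loc p (ball 0 1)"
    by (rule Lp_loc_ell_bound[where C=2]) (use assms profile_measurable profile_bound[OF e, of 0] in auto)
  moreover have "profile_grad e 0 \<in> Lp_loc p (ball 0 1)"
    by (rule Lp_loc_ell_bound[where C=2]) (use assms profile_grad_measurable profile_grad_bound[OF e, of 0] in auto)
  ultimately show ?thesis using profile_has_weak_gradient[OF e] by (auto simp: W1p_loc_def)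
qed

lemma flux_weakly_divergence_free:
  fixes e :: "'a::euclidean_space"
  assumes e: "norm e = 1" and n: "2 \<le> DIM('a)" and \<phi>: "\<phi> \<in> C1_c (ball 0 1)"
  shows "(LINT x:ball 0 1|lebesgue. flux e 0 x \<bullet> grad \<phi> x) = 0"
proof -
  obtain M where M: "0 \<le> M" "\<And>x. \<bar>\<phi> x\<bar> \<le> M" "\<And>x. norm (grad \<phi> x) \<le> M" using C1_c_bounded[OF \<phi>] by blast
  note [measurable] = C1_c_measurable[OF \<phi>] flux_measurable
  have m: "(\<lambda>x. flux e d x \<bullet> grad \<phi> x) \<in> borel_measurable lebesgue" for d
    by (rule measurable_completion) measurable
  have bd: "norm (flux e d x \<bullet> grad \<phi> x) \<le> (2 * M) * (ell ((norm x)\<^sup>2))\<^sup>2"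
    if "0 \<le> d" "d \<le> 1" "norm x < 1" "x \<noteq> 0" for d x
  proof -
    have "norm (flux e d x \<bullet> grad \<phi> x) \<le> norm (flux e d x) * norm (grad \<phi> x)"
      by (simp add: Cauchy_Schwarz_ineq2)
    also have "\<dots> \<le> (2 * (ell ((norm x)\<^sup>2))\<^sup>2) * M"
      using flux_bound[OF e that n] M by (intro mult_mono) auto
    finally show ?thesis by (simp add: mult_ac)
  qed
  have "(\<lambda>k. LINT x:ball 0 1|lebesgue. flux e (shrink k) x \<bullet> grad \<phi> x)
      \<longlonglongrightarrow> (LINT x:ball 0 1|lebesgue. flux e 0 x \<bullet> grad \<phi> x)"
    by (rule ell_dominated_limit[OF m m, where C="2 * M"])
      (erule (1) bd[OF less_imp_le[OF shrink(1)] shrink(2)],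
        intro tendsto_inner tendsto_const tendsto_regularised shrink(3) n)
  then show ?thesis
    unfolding flux_divergence_free[OF shrink(1) n \<phi>] by (simp add: LIMSEQ_const_iff)
qed

section \<open>The coefficient matrix\<close>

text \<open>The function \<open>(x \<bullet> e) * v r\<close> with \<open>r = norm x\<close> is a first spherical harmonic times a radial
  function. For a matrix field with radial eigenvalue \<open>1\<close> and tangential eigenvalue \<open>1 + a r\<close>, the
  equation for it becomes \<open>(n - 1) * a r * v r = r\<^sup>2 * v'' r + (n + 1) * r * v' r\<close>.
  Solving this for \<open>a\<close> with \<open>v r = (ell (r\<^sup>2))\<^sup>2\<close> gives the formula. As \<open>r\<close> tends to \<open>0\<close>, \<open>a r\<close>
  decays like the inverse of the weight; hence the value \<open>0\<close> at the origin.\<close>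
definition anisotropy :: "real^'n \<Rightarrow> real" where
  "anisotropy x = (if x = 0 then 0
     else 4 * (2 - CARD('n) * ell (x \<bullet> x)) / ((real CARD('n) - 1) * (ell (x \<bullet> x))\<^sup>2))"

definition radial_projection :: "real^'n \<Rightarrow> real^'n^'n" where
  "radial_projection x = (\<chi> i j. x $ i * x $ j / (x \<bullet> x))"

definition coefficient :: "real^'n \<Rightarrow> real^'n^'n" where
  "coefficient x = mat 1 + anisotropy x *\<^sub>R (mat 1 - radial_projection x)"

lemma radial_projection_apply: "radial_projection x *v \<xi> = ((x \<bullet> \<xi>) / (x \<bullet> x)) *\<^sub>R x"
proof (rule vec_eq_iff[THEN iffD2, rule_format])
  fix i
  have "(radial_projection x *v \<xi>) $ i = (\<Sum>j\<in>UNIV. x $ i / (x \<bullet> x) * (x $ j * \<xi> $ j))"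
    by (simp add: radial_projection_def matrix_vector_mult_def mult.assoc)
  also have "\<dots> = x $ i / (x \<bullet> x) * (x \<bullet> \<xi>)"
    unfolding sum_distrib_left[symmetric] by (simp add: inner_vec_def[of x \<xi>])
  finally show "(radial_projection x *v \<xi>) $ i = (((x \<bullet> \<xi>) / (x \<bullet> x)) *\<^sub>R x) $ i" by simp
qed

lemma coefficient_apply:
  "coefficient x *v \<xi> = \<xi> + anisotropy x *\<^sub>R (\<xi> - ((x \<bullet> \<xi>) / (x \<bullet> x)) *\<^sub>R x)"
  by (simp add: coefficient_def matrix_vector_mult_add_rdistrib matrix_vector_mult_diff_rdistrib
      radial_projection_apply flip: scaleR_matrix_vector_assoc)

lemma transpose_coefficient: "transpose (coefficient x) = coefficient x"
  by (simp add: vec_eq_iff transpose_def coefficient_def radial_projection_def mat_def mult.commute)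

text \<open>The bound by \<open>8 / ell (x \<bullet> x)\<close> uses \<open>n \<le> 2 * (n - 1)\<close>, that is,
  \<open>n \<ge> 2\<close>; together with \<open>16 \<le> ell (x \<bullet> x)\<close> it gives the constant \<open>1/2\<close>.\<close>
lemma anisotropy_bounds:
  fixes x :: "real^'n"
  assumes n: "2 \<le> CARD('n)" and x: "norm x < 1"
  shows "anisotropy x \<le> 0" "- (1/2) \<le> anisotropy x"
    and "x \<noteq> 0 \<Longrightarrow> \<bar>anisotropy x\<bar> \<le> 8 / ell (x \<bullet> x)"
proof -
  have *: "anisotropy x \<le> 0 \<and> \<bar>anisotropy x\<bar> \<le> 8 / ell (x \<bullet> x) \<and> 16 \<le> ell (x \<bullet> x)" if "x \<noteq> 0"
  proof -
    define l where "l = ell (x \<bullet> x)"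
    define n where "n = real CARD('n)"
    have n2: "2 \<le> n" using n by (simp add: n_def)
    have "x \<bullet> x = (norm x)\<^sup>2" by (simp add: power2_norm_eq_inner)
    then have "0 < x \<bullet> x" "x \<bullet> x \<le> 1" using that x by (auto simp: power_le_one)
    then have l: "16 \<le> l" unfolding l_def by (rule ell_ge_16)
    have nl: "2 * 16 \<le> n * l" using n2 l by (intro mult_mono) auto
    have nonneg: "0 \<le> 4 * (n * l - 2) / ((n - 1) * l\<^sup>2)" using n2 nl
      by (intro divide_nonneg_nonneg mult_nonneg_nonneg) (linarith | simp)+
    have a: "anisotropy x = - (4 * (n * l - 2) / ((n - 1) * l\<^sup>2))"
      using that by (simp add: anisotropy_def l_def n_def minus_divide_left algebra_simps)
    have "anisotropy x \<le> 0" using nonneg unfolding a by linarith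
    moreover have "\<bar>anisotropy x\<bar> = 4 * (n * l - 2) / ((n - 1) * l\<^sup>2)"
      unfolding a abs_minus_cancel using nonneg by (rule abs_of_nonneg)
    moreover have "4 * (n * l - 2) / ((n - 1) * l\<^sup>2) \<le> 8 / l"
    proof -
      have "4 * (n * l - 2) \<le> 8 * ((n - 1) * l)" 
      proof -
        have "2 * l \<le> n * l" using n2 l by (intro mult_right_mono) auto
        moreover have "4 * (y - 2) \<le> 8 * (y - l)" if "2 * l \<le> y" for y using that by simp
        ultimately show ?thesis by (simp only: left_diff_distrib mult_1)
      qed
      then have "4 * (n * l - 2) / ((n - 1) * l\<^sup>2) \<le> 8 * ((n - 1) * l) / ((n - 1) * l\<^sup>2)"
        using n2 by (intro divide_right_mono) auto
      also have "\<dots> = 8 / l" using n2 l by (simp add: power2_eq_square)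
      finally show ?thesis .
    qed
    ultimately show ?thesis using l by (simp add: l_def)
  qed
  show "anisotropy x \<le> 0" using * by (cases "x = 0") (auto simp: anisotropy_def)
  show "- (1/2) \<le> anisotropy x"
  proof (cases "x = 0")
    case False
    then have "\<bar>anisotropy x\<bar> \<le> 8 / ell (x \<bullet> x)" "8 / ell (x \<bullet> x) \<le> 8 / 16"
      using * by (auto intro!: divide_left_mono)
    then show ?thesis by linarith
  qed (simp add: anisotropy_def)
  show "x \<noteq> 0 \<Longrightarrow> \<bar>anisotropy x\<bar> \<le> 8 / ell (x \<bullet> x)" using * by blast
qed

lemma norm_mat_minus_radial_projection:
  fixes x :: "real^'n"
  shows "norm (mat 1 - radial_projection x) \<le> 2 * (real CARD('n))\<^sup>2"
proof -
  have entry: "\<bar>(mat 1 - radial_projection x) $ i $ j\<bar> \<le> 2" for i j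
  proof -
    have "\<bar>x $ i\<bar> * \<bar>x $ j\<bar> \<le> norm x * norm x" by (intro mult_mono component_le_norm_cart) auto
    also have "\<dots> = x \<bullet> x" by (simp add: power2_norm_eq_inner flip: power2_eq_square)
    finally have "\<bar>x $ i * x $ j / (x \<bullet> x)\<bar> \<le> 1"
      by (simp add: abs_mult divide_le_eq_1)
    moreover have "\<bar>(mat 1 :: real^'n^'n) $ i $ j\<bar> \<le> 1" by (simp add: mat_def)
    moreover have "(mat 1 - radial_projection x) $ i $ j = (mat 1 :: real^'n^'n) $ i $ j - x $ i * x $ j / (x \<bullet> x)"
      by (simp add: radial_projection_def)
    ultimately show ?thesis by linarith
  qed
  have "norm (mat 1 - radial_projection x) \<le> (\<Sum>i\<in>UNIV. norm ((mat 1 - radial_projection x) $ i))"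
    by (simp add: norm_vec_def L2_set_le_sum)
  also have "\<dots> \<le> (\<Sum>i\<in>(UNIV::'n set). \<Sum>j\<in>(UNIV::'n set). 2)"
    by (intro sum_mono order_trans[OF norm_le_l1_cart] entry)
  finally show ?thesis by (simp add: power2_eq_square)
qed

lemma tendsto_inverse_ell: "((\<lambda>x::'a::euclidean_space. 8 / ell (x \<bullet> x)) \<longlongrightarrow> 0) (at 0)"
proof -
  have "((\<lambda>x::'a. x \<bullet> x) \<longlongrightarrow> 0) (at 0)" by (auto intro!: tendsto_eq_intros)
  then have "filterlim (\<lambda>x::'a. x \<bullet> x) (at_right 0) (at 0)"
    by (auto simp: filterlim_at eventually_at_filter)
  then have "filterlim (\<lambda>x::'a. ln (x \<bullet> x)) at_bot (at 0)" by (rule filterlim_compose[OF ln_at_0])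
  then have "filterlim (\<lambda>x::'a. - ln (x \<bullet> x)) at_top (at 0)" by (simp add: filterlim_uminus_at_top)
  then have "filterlim (\<lambda>x::'a. 16 + - ln (x \<bullet> x)) at_top (at 0)"
    by (rule filterlim_tendsto_add_at_top[OF tendsto_const])
  then have "filterlim (\<lambda>x::'a. ell (x \<bullet> x)) at_infinity (at 0)"
    unfolding ell_def by (simp add: filterlim_at_top_imp_at_infinity)
  then show ?thesis by (rule tendsto_divide_0[OF tendsto_const])
qed

text \<open>The radial projection is discontinuous at the origin but bounded, and it is multiplied by
  the anisotropy, which tends to \<open>0\<close> there.\<close>
lemma continuous_on_coefficient:
  assumes n: "2 \<le> CARD('n)"
  shows "continuous_on (ball 0 1) (coefficient :: real^'n \<Rightarrow> _)"
proof (rule continuous_at_imp_continuous_on, rule ballI)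
  fix x :: "real^'n" assume x: "x \<in> ball 0 1"
  show "isCont coefficient x"
  proof (cases "x = 0")
    case True
    have "((\<lambda>y::real^'n. anisotropy y *\<^sub>R (mat 1 - radial_projection y)) \<longlongrightarrow> 0) (at 0)"
    proof (rule Lim_null_comparison)
      show "((\<lambda>y::real^'n. 8 / ell (y \<bullet> y) * (2 * (real CARD('n))\<^sup>2)) \<longlongrightarrow> 0) (at 0)"
        by (rule tendsto_mult_left_zero[OF tendsto_inverse_ell])
      have "\<forall>\<^sub>F y in at (0::real^'n). y \<in> ball 0 1" by (rule eventually_at_in_open') auto
      moreover have "\<forall>\<^sub>F y in at (0::real^'n). y \<noteq> 0" by (simp add: eventually_at_filter)
      ultimately show "\<forall>\<^sub>F y in at (0::real^'n). norm (anisotropy y *\<^sub>R (mat 1 - radial_projection y))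
          \<le> 8 / ell (y \<bullet> y) * (2 * (real CARD('n))\<^sup>2)"
      proof eventually_elim
        case (elim y)
        then have "\<bar>anisotropy y\<bar> \<le> 8 / ell (y \<bullet> y)" using anisotropy_bounds(3)[OF n] by simp
        moreover from this have "0 \<le> 8 / ell (y \<bullet> y)"
          using abs_ge_zero[of "anisotropy y"] by linarith
        ultimately show ?case
          unfolding norm_scaleR using norm_mat_minus_radial_projection[of y]
          by (intro mult_mono norm_ge_zero)
      qed
    qed
    then have "((\<lambda>y::real^'n. mat 1 + anisotropy y *\<^sub>R (mat 1 - radial_projection y)) \<longlongrightarrow> mat 1 + 0) (at 0)"
      by (intro tendsto_add tendsto_const)
    then show ?thesis by (simp add: True isCont_def coefficient_def[abs_def] anisotropy_def)
  next
    case False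
    define a where "a y = 4 * (2 - CARD('n) * ell (y \<bullet> y)) / ((real CARD('n) - 1) * (ell (y \<bullet> y))\<^sup>2)" for y :: "real^'n"
    have nz: "x \<bullet> x \<noteq> 0" using False by simp
    have "x \<bullet> x = (norm x)\<^sup>2" by (simp add: power2_norm_eq_inner)
    then have "0 < x \<bullet> x" "x \<bullet> x \<le> 1" using False x by (auto simp: power_le_one)
    then have "16 \<le> ell (x \<bullet> x)" by (rule ell_ge_16)
    then have nz': "(real CARD('n) - 1) * (ell (x \<bullet> x))\<^sup>2 \<noteq> 0" using n by auto
    have id: "((\<lambda>y. y) \<longlongrightarrow> x) (at x)" by (rule tendsto_ident_at)
    have l: "((\<lambda>y. ell (y \<bullet> y)) \<longlongrightarrow> ell (x \<bullet> x)) (at x)"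
      unfolding ell_def by (intro tendsto_intros nz)
    have "((\<lambda>y. mat 1 + a y *\<^sub>R (mat 1 - radial_projection y)) \<longlongrightarrow> mat 1 + a x *\<^sub>R (mat 1 - radial_projection x)) (at x)"
      unfolding a_def radial_projection_def by (intro tendsto_intros l nz nz')
    moreover have "\<forall>\<^sub>F y in at x. mat 1 + a y *\<^sub>R (mat 1 - radial_projection y) = coefficient y"
    proof -
      have "\<forall>\<^sub>F y in at x. y \<noteq> 0" using False by (intro eventually_neq_at_within)
      then show ?thesis by eventually_elim (simp add: coefficient_def a_def anisotropy_def)
    qed
    moreover have "mat 1 + a x *\<^sub>R (mat 1 - radial_projection x) = coefficient x"
      using False by (simp add: coefficient_def a_def anisotropy_def)
    ultimately have "(coefficient \<longlongrightarrow> coefficient x) (at x)" by (simp add: Lim_transform_eventually)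
    then show ?thesis by (simp add: isCont_def)
  qed
qed

text \<open>The quadratic form is \<open>\<xi> \<bullet> \<xi> + anisotropy x * q\<close>, where \<open>q\<close> is the squared norm of the
  tangential part of \<open>\<xi>\<close> and lies between \<open>0\<close> and \<open>\<xi> \<bullet> \<xi>\<close>.\<close>
lemma elliptic_coefficient:
  assumes n: "2 \<le> CARD('n)"
  shows "elliptic (ball 0 1) (coefficient :: real^'n \<Rightarrow> _)"
  unfolding elliptic_def
proof (intro conjI ballI)
  show "(coefficient :: real^'n \<Rightarrow> _) \<in> borel_measurable (lebesgue_on (ball 0 1))"
    by (rule continuous_imp_measurable_on_sets_lebesgue[OF continuous_on_coefficient[OF n]]) simp
  have "norm (coefficient x) \<le> norm (mat 1 :: real^'n^'n) + 1 * (2 * (real CARD('n))\<^sup>2)"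
    if "x \<in> ball 0 1" for x :: "real^'n"
  proof -
    have "\<bar>anisotropy x\<bar> \<le> 1" using anisotropy_bounds(1,2)[OF n, of x] that by auto
    then have "norm (anisotropy x *\<^sub>R (mat 1 - radial_projection x)) \<le> 1 * (2 * (real CARD('n))\<^sup>2)"
      unfolding norm_scaleR using norm_mat_minus_radial_projection[of x] by (intro mult_mono) auto
    then show ?thesis unfolding coefficient_def by (intro norm_triangle_mono) auto
  qed
  then show "bounded ((coefficient :: real^'n \<Rightarrow> _) ` ball 0 1)" unfolding bounded_iff by blast
  show "transpose (coefficient x) = coefficient x" for x :: "real^'n" by (rule transpose_coefficient)
  have "1/2 * (norm \<xi>)\<^sup>2 \<le> (coefficient x *v \<xi>) \<bullet> \<xi> \<and> (coefficient x *v \<xi>) \<bullet> \<xi> \<le> 1 * (norm \<xi>)\<^sup>2"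
    if "x \<in> ball 0 1" for x \<xi> :: "real^'n"
  proof -
    define q where "q = \<xi> \<bullet> \<xi> - (x \<bullet> \<xi>)\<^sup>2 / (x \<bullet> x)"
    have eq: "(coefficient x *v \<xi>) \<bullet> \<xi> = \<xi> \<bullet> \<xi> + anisotropy x * q"
      by (simp add: coefficient_apply inner_add_left inner_diff_left q_def power2_eq_square)
    have "(x \<bullet> \<xi>)\<^sup>2 \<le> (\<xi> \<bullet> \<xi>) * (x \<bullet> x)" using Cauchy_Schwarz_ineq[of x \<xi>] by (simp add: mult.commute)
    then have "(x \<bullet> \<xi>)\<^sup>2 / (x \<bullet> x) \<le> \<xi> \<bullet> \<xi>" by (cases "x = 0") (auto simp: divide_le_eq)
    then have q: "0 \<le> q" "q \<le> \<xi> \<bullet> \<xi>" by (auto simp: q_def)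
    have a: "anisotropy x \<le> 0" "- (1/2) \<le> anisotropy x"
      using anisotropy_bounds(1,2)[OF n, of x] that by auto
    have "anisotropy x * q \<le> 0" using a q by (simp add: mult_nonpos_nonneg)
    moreover have "- (1/2) * q \<le> anisotropy x * q" using a q by (intro mult_right_mono) auto
    ultimately show ?thesis using q unfolding eq by (simp add: power2_norm_eq_inner)
  qed
  then show "\<exists>l>0. \<exists>L>0. \<forall>x\<in>ball 0 1. \<forall>\<xi>::real^'n.
      l * (norm \<xi>)\<^sup>2 \<le> (coefficient x *v \<xi>) \<bullet> \<xi> \<and> (coefficient x *v \<xi>) \<bullet> \<xi> \<le> L * (norm \<xi>)\<^sup>2"
    by (intro exI[of _ "1/2::real"] exI[of _ "1::real"] conjI) auto
qed

text \<open>Both sides are combinations of \<open>e\<close> and \<open>x\<close>. Comparing them leaves the single identity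
  \<open>a * l\<^sup>2 = h * s - 4 * l\<close> between the anisotropy \<open>a\<close> and the potential slope \<open>h\<close>.\<close>
lemma coefficient_profile_grad:
  fixes x :: "real^'n"
  assumes n: "2 \<le> CARD('n)" and x: "norm x < 1" "x \<noteq> 0"
  shows "coefficient x *v profile_grad e 0 x = flux e 0 x"
proof -
  define s where "s = x \<bullet> x"
  define l where "l = ell s"
  define a where "a = anisotropy x"
  define h where "h = potential_slope CARD('n) s"
  have s: "0 < s" using x by (simp add: s_def)
  have "x \<bullet> x = (norm x)\<^sup>2" by (simp add: power2_norm_eq_inner)
  then have "s \<le> 1" using x by (auto simp: power_le_one s_def)
  then have l: "16 \<le> l" unfolding l_def using s by (intro ell_ge_16)
  have n1: "real CARD('n) - 1 \<noteq> 0" using n by simp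
  have hs: "h * s = (8 - 4 * l) / (real CARD('n) - 1)"
    using s by (simp add: h_def potential_slope_def l_def)
  have al: "a * l\<^sup>2 = h * s - 4 * l"
  proof -
    have "a * l\<^sup>2 = 4 * (2 - CARD('n) * l) / (real CARD('n) - 1)"
      using x l by (simp add: a_def anisotropy_def l_def s_def)
    then show ?thesis unfolding hs using n1 by (simp add: field_simps)
  qed
  have P: "profile_grad e 0 x = l\<^sup>2 *\<^sub>R e - (4 * l * (x \<bullet> e) / s) *\<^sub>R x"
    by (simp add: profile_grad_def Let_def l_def s_def)
  have xP: "(x \<bullet> profile_grad e 0 x) / s = (l\<^sup>2 - 4 * l) * (x \<bullet> e) / s"
    unfolding P using s by (simp add: inner_diff_right s_def[symmetric] algebra_simps)
  have "coefficient x *v profile_grad e 0 x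
      = profile_grad e 0 x + a *\<^sub>R (profile_grad e 0 x - ((x \<bullet> profile_grad e 0 x) / s) *\<^sub>R x)"
    by (simp only: coefficient_apply s_def a_def)
  also have "\<dots> = (1 + a) *\<^sub>R profile_grad e 0 x - (a * ((l\<^sup>2 - 4 * l) * (x \<bullet> e) / s)) *\<^sub>R x"
    unfolding xP by (simp add: algebra_simps)
  also have "\<dots> = (l\<^sup>2 + a * l\<^sup>2) *\<^sub>R e - ((4 * l + a * l\<^sup>2) / s * (x \<bullet> e)) *\<^sub>R x"
    unfolding P by (simp add: algebra_simps diff_divide_distrib add_divide_distrib)
  also have "l\<^sup>2 + a * l\<^sup>2 = l\<^sup>2 - 4 * l + h * s" using al by simp
  also have "(4 * l + a * l\<^sup>2) / s = h" using al s by simp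
  finally show ?thesis by (simp add: flux_def Let_def s_def[symmetric] h_def l_def)
qed

lemma profile_weak_solution:
  fixes e :: "real^'n"
  assumes n: "2 \<le> CARD('n)" and e: "norm e = 1"
  shows "weak_solution (ball 0 1) coefficient (profile e 0)"
  unfolding weak_solution_def
proof (intro conjI exI ballI)
  show "profile e 0 \<in> W1p_loc 1 (ball 0 1)" by (rule profile_in_W1p_loc[OF e]) simp
  show "has_weak_gradient (ball 0 1) (profile e 0) (profile_grad e 0)"
    by (rule profile_has_weak_gradient[OF e])
  fix \<phi> assume \<phi>: "\<phi> \<in> C1_c (ball (0::real^'n) 1)"
  have "(LINT x:ball 0 1|lebesgue. (coefficient x *v profile_grad e 0 x) \<bullet> grad \<phi> x)
      = (LINT x:ball 0 1|lebesgue. flux e 0 x \<bullet> grad \<phi> x)"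
    unfolding set_lebesgue_integral_def
    \<comment> \<open>the origin is exceptional because the radial direction is undefined there\<close>
    by (rule integral_discrete_difference[where X="{0}"])
      (auto simp: indicator_def coefficient_profile_grad[OF n])
  also have "\<dots> = 0" using n by (intro flux_weakly_divergence_free[OF e _ \<phi>]) simp
  finally show "(LINT x:ball 0 1|lebesgue. (coefficient x *v profile_grad e 0 x) \<bullet> grad \<phi> x) = 0" .
qed

section \<open>Unbounded mean oscillation\<close>

lemma measure_lebesgue_ball:
  "0 \<le> r \<Longrightarrow> measure lebesgue (ball (c::'a::euclidean_space) r) = unit_ball_vol DIM('a) * r ^ DIM('a)"
  by (simp add: content_ball)

lemma set_integrable_lebesgue_const:
  "set_integrable lebesgue (ball (c::'a::euclidean_space) r) (\<lambda>_. v :: 'b::euclidean_space)"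
  unfolding set_integrable_def
  by (rule integrable_scaleR_left) (use emeasure_lborel_ball_finite[of c r] in \<open>auto intro!: integrable_real_indicator\<close>)

text \<open>The difference of the two averages is the average of \<open>f - avg\<close> over the small ball, and the
  large ball has \<open>2 ^ DIM('a)\<close> times its volume.\<close>
lemma norm_avg_subball_diff_le:
  fixes f :: "'a::euclidean_space \<Rightarrow> 'b::euclidean_space"
  assumes f: "set_integrable lebesgue (ball c (2 * r)) f" and r: "0 < r"
  shows "norm (avg (ball c r) f - avg (ball c (2 * r)) f)
    \<le> 2 ^ DIM('a) * avg (ball c (2 * r)) (\<lambda>x. norm (f x - avg (ball c (2 * r)) f))"
proof -
  let ?S = "ball c r" and ?B = "ball c (2 * r)"
  define a where "a = avg ?B f"
  have sub: "?S \<subseteq> ?B" using r by auto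
  have fS: "set_integrable lebesgue ?S f" by (rule set_integrable_subset[OF f _ sub]) simp
  have gB: "set_integrable lebesgue ?B (\<lambda>x. f x - a)"
    by (rule set_integral_diff(1)[OF f set_integrable_lebesgue_const])
  have gS: "set_integrable lebesgue ?S (\<lambda>x. f x - a)" by (rule set_integrable_subset[OF gB _ sub]) simp
  have nB: "set_integrable lebesgue ?B (\<lambda>x. norm (f x - a))" by (rule set_integrable_norm[OF gB])
  have m: "measure lebesgue ?B = 2 ^ DIM('a) * measure lebesgue ?S" and mS: "0 < measure lebesgue ?S"
    using r by (simp_all only: measure_lebesgue_ball) (auto simp: power_mult_distrib)
  have "(LINT x:?S|lebesgue. f x - a) = (LINT x:?S|lebesgue. f x) - measure lebesgue ?S *\<^sub>R a"
    using emeasure_lborel_ball_finite[of c r]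
    by (subst set_integral_diff(2)[OF fS set_integrable_lebesgue_const]) (subst set_integral_const, auto)
  then have "avg ?S f - a = (1 / measure lebesgue ?S) *\<^sub>R (LINT x:?S|lebesgue. f x - a)"
    using mS by (simp add: avg_def scaleR_diff_right)
  then have "norm (avg ?S f - a) = (1 / measure lebesgue ?S) * norm (LINT x:?S|lebesgue. f x - a)"
    using mS by simp
  also have "norm (LINT x:?S|lebesgue. f x - a) \<le> (LINT x:?S|lebesgue. norm (f x - a))"
    using gS by (rule set_integral_norm_bound)
  also have "\<dots> \<le> (LINT x:?B|lebesgue. norm (f x - a))"
    unfolding set_lebesgue_integral_def
  proof (rule integral_mono)
    show "indicator ?S x *\<^sub>R norm (f x - a) \<le> indicator ?B x *\<^sub>R norm (f x - a)" for x
      using sub by (auto simp: indicator_def)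
  qed (use nB set_integrable_norm[OF gS] in \<open>auto simp: set_integrable_def\<close>)
  finally have "norm (avg ?S f - a) \<le> (1 / measure lebesgue ?S) * (LINT x:?B|lebesgue. norm (f x - a))"
    using mS by (simp add: mult_left_mono divide_right_mono)
  also have "\<dots> = 2 ^ DIM('a) * avg ?B (\<lambda>x. norm (f x - a))"
    using mS by (simp add: avg_def m)
  finally show ?thesis by (simp add: a_def)
qed

text \<open>Telescoping the previous estimate: halving the radius changes the average by a bounded
  amount, so averages over shrinking balls grow at most logarithmically in the inverse radius.\<close>
lemma BMO_avg_dyadic_growth:
  fixes f :: "'a::euclidean_space \<Rightarrow> 'b::euclidean_space"
  assumes f: "f \<in> BMO (ball c r)" and r: "0 < r"
  obtains C where "\<And>k. norm (avg (ball c (r * (1/2) ^ k)) f) \<le> norm (avg (ball c r) f) + real k * C"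
proof -
  from f have int: "set_integrable lebesgue (ball c r) f"
    and "bdd_above {avg (ball y s) (\<lambda>x. norm (f x - avg (ball y s) f)) | y s. 0 < s \<and> ball y s \<subseteq> ball c r}"
    by (auto simp: BMO_def)
  then obtain M where M: "\<And>y s. 0 < s \<Longrightarrow> ball y s \<subseteq> ball c r \<Longrightarrow> avg (ball y s) (\<lambda>x. norm (f x - avg (ball y s) f)) \<le> M"
    unfolding bdd_above_def by blast
  define a where "a k = avg (ball c (r * (1/2) ^ k)) f" for k
  have step: "norm (a (Suc k) - a k) \<le> 2 ^ DIM('a) * M" for k
  proof -
    define s where "s = r * (1/2) ^ Suc k"
    have s: "0 < s" "2 * s = r * (1/2) ^ k" using r by (auto simp: s_def)
    have "2 * s \<le> r" unfolding s(2) using r by (simp add: power_le_one mult_left_le)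
    then have sub: "ball c (2 * s) \<subseteq> ball c r" by (rule subset_ball)
    have "set_integrable lebesgue (ball c (2 * s)) f" by (rule set_integrable_subset[OF int _ sub]) simp
    then have "norm (avg (ball c s) f - avg (ball c (2 * s)) f)
        \<le> 2 ^ DIM('a) * avg (ball c (2 * s)) (\<lambda>x. norm (f x - avg (ball c (2 * s)) f))"
      using s(1) by (rule norm_avg_subball_diff_le)
    also have "\<dots> \<le> 2 ^ DIM('a) * M" using M[OF _ sub] s(1) by simp
    finally show ?thesis unfolding s(2) by (simp add: a_def s_def)
  qed
  have "norm (a k) \<le> norm (a 0) + real k * (2 ^ DIM('a) * M)" for k
  proof (induction k)
    case (Suc k)
    have "norm (a (Suc k)) \<le> norm (a k) + norm (a (Suc k) - a k)" by (metis add.commute diff_add_cancel norm_triangle_ineq)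
    then show ?case using Suc step[of k] by (simp add: algebra_simps)
  qed simp
  then show thesis using that[of "2 ^ DIM('a) * M"] by (simp add: a_def)
qed

text \<open>In direction \<open>e\<close>, the gradient is at least \<open>l\<^sup>2 - 4 * l\<close> with \<open>l = ell (x \<bullet> x) \<ge> 16\<close>, and
  \<open>l\<close> exceeds \<open>k\<close> on the ball of radius \<open>(1/2) ^ (k + 1)\<close> because \<open>ln 4 \<ge> 1\<close>.\<close>
lemma profile_grad_avg_lower:
  fixes e :: "'a::euclidean_space"
  assumes e: "norm e = 1"
    and int: "set_integrable lebesgue (ball 0 (1/2 * (1/2) ^ k)) (profile_grad e 0)"
  shows "3/4 * (real k)\<^sup>2 \<le> norm (avg (ball 0 (1/2 * (1/2) ^ k)) (profile_grad e 0))"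
proof -
  let ?r = "1/2 * (1/2::real) ^ k"
  let ?B = "ball (0::'a) ?r"
  have lower: "3/4 * (real k)\<^sup>2 \<le> profile_grad e 0 x \<bullet> e" if x: "x \<in> ?B" "x \<noteq> 0" for x
  proof -
    define l where "l = ell (x \<bullet> x)"
    have xx: "x \<bullet> x = (norm x)\<^sup>2" by (simp add: power2_norm_eq_inner)
    then have pos: "0 < x \<bullet> x" using x by simp
    have "x \<bullet> x \<le> ?r\<^sup>2" unfolding xx using x(1) by (intro power_mono) auto
    also have "?r\<^sup>2 = (1/4) ^ Suc k" by (simp add: power2_eq_square power_mult_distrib[symmetric])
    finally have le: "x \<bullet> x \<le> (1/4) ^ Suc k" .
    then have "x \<bullet> x \<le> 1" by (rule order_trans) (simp add: power_le_one del: power_Suc)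
    then have l16: "16 \<le> l" unfolding l_def using pos by (intro ell_ge_16)
    have "ln (4::real) = 2 * ln 2" using ln_realpow[of 2 2] by simp
    then have "1 \<le> ln (4::real)" using ln2_ge_two_thirds by linarith
    then have "real (Suc k) * 1 \<le> real (Suc k) * ln 4" by (intro mult_left_mono) auto
    then have "real k \<le> real (Suc k) * ln 4" by (rule order_trans[rotated]) simp
    moreover have "ln ((1/4::real) ^ Suc k) = - (real (Suc k) * ln 4)"
      by (subst ln_realpow) (auto simp: ln_div)
    moreover have "ell ((1/4) ^ Suc k) \<le> l" unfolding l_def using pos le by (rule ell_antimono)
    ultimately have lk: "real k \<le> l" unfolding ell_def by linarith
    have "(x \<bullet> e)\<^sup>2 \<le> (x \<bullet> x) * (e \<bullet> e)" by (rule Cauchy_Schwarz_ineq)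
    also have "e \<bullet> e = 1" using e by (simp add: dot_square_norm)
    finally have "(x \<bullet> e)\<^sup>2 / (x \<bullet> x) \<le> 1" using pos by (simp add: divide_le_eq)
    then have "4 * l * ((x \<bullet> e)\<^sup>2 / (x \<bullet> x)) \<le> 4 * l * 1" using l16 by (intro mult_left_mono) auto
    moreover have "profile_grad e 0 x \<bullet> e = l\<^sup>2 - 4 * l * ((x \<bullet> e)\<^sup>2 / (x \<bullet> x))"
      using \<open>e \<bullet> e = 1\<close> by (simp add: profile_grad_def Let_def l_def inner_diff_left power2_eq_square)
    moreover have "16 * l \<le> l\<^sup>2" using l16 unfolding power2_eq_square by (intro mult_right_mono) auto
    moreover have "(real k)\<^sup>2 \<le> l\<^sup>2" using lk by (intro power_mono) auto
    ultimately show ?thesis by linarith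
  qed
  have m: "0 < measure lebesgue ?B" by (subst measure_lebesgue_ball) auto
  have "measure lebesgue ?B * (3/4 * (real k)\<^sup>2) = (LINT x:?B|lebesgue. 3/4 * (real k)\<^sup>2)"
    using emeasure_lborel_ball_finite[of "0::'a" ?r] by (subst set_integral_const) auto
  also have "\<dots> \<le> (LINT x:?B|lebesgue. profile_grad e 0 x \<bullet> e)"
  proof (rule set_integral_mono_AE[OF set_integrable_lebesgue_const])
    show "set_integrable lebesgue ?B (\<lambda>x. profile_grad e 0 x \<bullet> e)"
      using int unfolding set_integrable_def by (simp flip: inner_scaleR_left)
    show "AE x\<in>?B in lebesgue. 3/4 * (real k)\<^sup>2 \<le> profile_grad e 0 x \<bullet> e"
      using AE_completion[OF AE_lborel_singleton[of "0::'a"]] by (rule eventually_mono) (use lower in auto)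
  qed
  also have "\<dots> = (LINT x:?B|lebesgue. profile_grad e 0 x) \<bullet> e"
    using int unfolding set_integrable_def set_lebesgue_integral_def by (simp flip: inner_scaleR_left)
  also have "\<dots> \<le> norm (LINT x:?B|lebesgue. profile_grad e 0 x) * 1"
    using norm_cauchy_schwarz[of "LINT x:?B|lebesgue. profile_grad e 0 x" e] e by simp
  finally have "3/4 * (real k)\<^sup>2 \<le> norm (LINT x:?B|lebesgue. profile_grad e 0 x) / measure lebesgue ?B"
    using m by (simp add: field_simps)
  then show ?thesis using m by (simp add: avg_def)
qed

text \<open>On balls of radius \<open>(1/2) ^ (k + 1)\<close> the averages grow at least quadratically in \<open>k\<close>, whereas
  bounded mean oscillation would allow only linear growth.\<close>
lemma profile_grad_not_BMO_loc:
  fixes e :: "'a::euclidean_space"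
  assumes e: "norm e = 1"
  shows "profile_grad e 0 \<notin> BMO_loc (ball 0 1)"
proof
  assume "profile_grad e 0 \<in> BMO_loc (ball 0 1)"
  moreover have "closure (ball (0::'a) (1/2)) = cball 0 (1/2)" by simp
  moreover have "cball (0::'a) (1/2) \<subseteq> ball 0 1" by auto
  ultimately have BMO: "profile_grad e 0 \<in> BMO (ball 0 (1/2))"
    unfolding BMO_loc_def by (simp del: closure_ball)
  then obtain C where C: "\<And>k. norm (avg (ball 0 (1/2 * (1/2) ^ k)) (profile_grad e 0))
      \<le> norm (avg (ball 0 (1/2)) (profile_grad e 0)) + real k * C"
    using BMO_avg_dyadic_growth[of "profile_grad e 0" 0 "1/2"] by auto
  define D where "D = norm (avg (ball 0 (1/2)) (profile_grad e 0))"
  obtain k :: nat where k: "2 * (D + \<bar>C\<bar> + 1) < real k" using reals_Archimedean2 by blast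
  have D: "0 \<le> D" by (simp add: D_def)
  define E where "E = D + \<bar>C\<bar>"
  have E: "0 \<le> E" "2 * (E + 1) < real k" using D k by (simp_all add: E_def)
  then have k1: "1 \<le> real k" by simp
  have "set_integrable lebesgue (ball 0 (1/2)) (profile_grad e 0)" using BMO by (simp add: BMO_def)
  then have "set_integrable lebesgue (ball 0 (1/2 * (1/2) ^ k)) (profile_grad e 0)"
    by (rule set_integrable_subset) (auto intro!: subset_ball simp: power_le_one)
  from profile_grad_avg_lower[OF e this] C[of k]
  have "3/4 * (real k)\<^sup>2 \<le> D + real k * C" by (simp add: D_def)
  also have "\<dots> \<le> real k * D + real k * \<bar>C\<bar>"
    using mult_right_mono[OF k1 D] by (intro add_mono mult_left_mono) auto
  finally have "real k * (3/4 * real k) \<le> real k * (D + \<bar>C\<bar>)" by (simp add: power2_eq_square algebra_simps)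
  then have "3/4 * real k \<le> E" unfolding E_def using k1 by (subst (asm) mult_le_cancel_left_pos) auto
  then show False using E by simp
qed

theorem proposition1p6:
  assumes "CARD('n::finite) \<ge> 2"
  shows "\<exists>(u :: real^'n \<Rightarrow> real) (Du :: real^'n \<Rightarrow> real^'n) (A :: real^'n \<Rightarrow> real^'n^'n).
      u \<in> W1p_loc 1 (ball 0 1)
    \<and> has_weak_gradient (ball 0 1) u Du
    \<and> elliptic (ball 0 1) A \<and> continuous_on (ball 0 1) A
    \<and> weak_solution (ball 0 1) A u
    \<and> (\<forall>p>1. u \<in> W1p_loc p (ball 0 1))
    \<and> Du \<notin> BMO_loc (ball 0 1)"
proof -
  obtain e :: "real^'n" where "e \<in> Basis" using nonempty_Basis by blast
  then have e: "norm e = 1" by simp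
  have "\<forall>p>1. profile e 0 \<in> W1p_loc p (ball 0 1)"
    using profile_in_W1p_loc[OF e] by auto
  then show ?thesis
    using profile_in_W1p_loc[OF e, of 1] profile_has_weak_gradient[OF e] elliptic_coefficient[OF assms]
      continuous_on_coefficient[OF assms] profile_weak_solution[OF assms e] profile_grad_not_BMO_loc[OF e]
    by (intro exI[of _ "profile e 0"] exI[of _ "profile_grad e 0"] exI[of _ coefficient] conjI) auto
qed

end
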